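(* Let $1 < \gamma < 2$ and let $\mathcal{I}_{\gamma}$ be the multilinear fractional integral operator given by \[ \mathcal{I}_{\gamma}(f_1,f_2)(x) = \iint_{\mathbb{R}^{2}} \frac{f_1(s)\, f_2(t)}{(|x-s|+|x-t|)^{2-\gamma}}\, ds\, dt, \qquad x \in \mathbb{R}. \] Then for every $p$ with $0 < p \leq \gamma^{-1}$, and $q$ defined by $\frac{1}{q} = 1 + \frac{1}{p} - \gamma$, the operator $\mathcal{I}_{\gamma}$ is not bounded from $H^{1}(\mathbb{R}) \times H^{p}(\mathbb{R})$ into $H^{q}(\mathbb{R})$.
   Context: For $0<p<\infty$, the Hardy space $H^p(\mathbb{R})$ consists of the tempered distributions $f \in \mathcal{S}'(\mathbb{R})$ such that, for some Schwartz function $\varphi$ with $\int \varphi = 1$, the maximal function $(\mathcal{M}_{\varphi} f)(x) = \sup_{t>0} |(\varphi_t * f)(x)|$ belongs to $L^p(\mathbb{R})$, where $\varphi_t(x) = \frac{1}{t}\varphi(\frac{x}{t})$. One sets $\|f\|_{H^p} := \|\mathcal{M}_{\varphi} f\|_{L^p}$; the space does not depend on the choice of $\varphi$ (different choices give equivalent quasi-norms). The integral defining $\mathcal{I}_{\gamma}(f_1,f_2)$ converges absolutely for almost every $x$ when $f_1, f_2$ are bounded and compactly supported. "Bounded from $H^1(\mathbb{R})\times H^p(\mathbb{R})$ into $H^q(\mathbb{R})$" means that there is a constant $C<\infty$ such that, for all bounded compactly supported functions $f_1 \in H^1(\mathbb{R})$ and $f_2 \in H^p(\mathbb{R})$, one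 has $\mathcal{I}_{\gamma}(f_1,f_2) \in H^q(\mathbb{R})$ and $\|\mathcal{I}_{\gamma}(f_1,f_2)\|_{H^q} \leq C \|f_1\|_{H^1}\|f_2\|_{H^p}$. "Not bounded" is the negation of this. *)

theory Defs
  imports "HOL-Analysis.Analysis"
begin

definition iter_deriv :: "nat \<Rightarrow> (real \<Rightarrow> complex) \<Rightarrow> real \<Rightarrow> complex" where
  "iter_deriv n f = ((\<lambda>g x. vector_derivative g (at x)) ^^ n) f"

definition schwartz :: "(real \<Rightarrow> complex) set" where
  "schwartz = {\<phi>. (\<forall>n x. iter_deriv n \<phi> differentiable (at x)) \<and>
                   (\<forall>k n. bounded (range (\<lambda>x. x ^ k *\<^sub>R iter_deriv n \<phi> x)))}"

definition schwartz_seminorm :: "nat \<Rightarrow> nat \<Rightarrow> (real \<Rightarrow> complex) \<Rightarrow> real" where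
  "schwartz_seminorm k n \<phi> = (SUP x. norm (x ^ k *\<^sub>R iter_deriv n \<phi> x))"

text \<open>A tempered distribution is represented by a total function on \<open>real \<Rightarrow> complex\<close>; only its
  values on \<^const>\<open>schwartz\<close> matter.\<close>

definition tempered :: "((real \<Rightarrow> complex) \<Rightarrow> complex) set" where
  "tempered = {T.
     (\<forall>\<phi>\<in>schwartz. \<forall>\<psi>\<in>schwartz. T (\<lambda>x. \<phi> x + \<psi> x) = T \<phi> + T \<psi>) \<and>
     (\<forall>c. \<forall>\<phi>\<in>schwartz. T (\<lambda>x. c * \<phi> x) = c * T \<phi>) \<and>
     (\<exists>C N. \<forall>\<phi>\<in>schwartz. norm (T \<phi>) \<le> C * (\<Sum>k\<le>N. \<Sum>n\<le>N. schwartz_seminorm k n \<phi>))}"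

definition dilate :: "(real \<Rightarrow> complex) \<Rightarrow> real \<Rightarrow> real \<Rightarrow> complex" where
  "dilate \<phi> t x = complex_of_real (1 / t) * \<phi> (x / t)"

definition conv_dist :: "(real \<Rightarrow> complex) \<Rightarrow> ((real \<Rightarrow> complex) \<Rightarrow> complex) \<Rightarrow> real \<Rightarrow> complex" where
  "conv_dist \<psi> T x = T (\<lambda>y. \<psi> (x - y))"

definition maximal_fn :: "(real \<Rightarrow> complex) \<Rightarrow> ((real \<Rightarrow> complex) \<Rightarrow> complex) \<Rightarrow> real \<Rightarrow> ennreal" where
  "maximal_fn \<phi> T x = (SUP t\<in>{0<..}. ennreal (norm (conv_dist (dilate \<phi> t) T x)))"

text \<open>Real powers on \<^typ>\<open>ennreal\<close>, meant for positive exponents.\<close>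

definition epowr :: "ennreal \<Rightarrow> real \<Rightarrow> ennreal" where
  "epowr a r = (if a = \<infinity> then \<infinity> else ennreal (enn2real a powr r))"

definition Lp_qnorm :: "real \<Rightarrow> (real \<Rightarrow> ennreal) \<Rightarrow> ennreal" where
  "Lp_qnorm p g = epowr (\<integral>\<^sup>+ x. epowr (g x) p \<partial>lebesgue) (1 / p)"

definition hardy_qnorm ::
    "(real \<Rightarrow> complex) \<Rightarrow> real \<Rightarrow> ((real \<Rightarrow> complex) \<Rightarrow> complex) \<Rightarrow> ennreal" where
  "hardy_qnorm \<phi> p T = Lp_qnorm p (maximal_fn \<phi> T)"

text \<open>Measurability of the maximal function need not be required: for \<open>T\<close> tempered it is a supremum
  of continuous functions, hence lower semicontinuous.\<close>

definition hardy :: "real \<Rightarrow> ((real \<Rightarrow> complex) \<Rightarrow> complex) set" where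
  "hardy p = {T \<in> tempered.
     \<exists>\<phi>\<in>schwartz. integral\<^sup>L lebesgue \<phi> = 1 \<and> hardy_qnorm \<phi> p T < \<infinity>}"

definition dist_of_fun :: "(real \<Rightarrow> complex) \<Rightarrow> (real \<Rightarrow> complex) \<Rightarrow> complex" where
  "dist_of_fun f \<phi> = (LINT x|lebesgue. f x * \<phi> x)"

text \<open>The integrability condition rules out functions for which \<^const>\<open>dist_of_fun\<close> only yields
  the default value of a divergent integral.\<close>

definition fun_in_hardy :: "real \<Rightarrow> (real \<Rightarrow> complex) \<Rightarrow> bool" where
  "fun_in_hardy p f \<longleftrightarrow>
     (\<forall>\<phi>\<in>schwartz. integrable lebesgue (\<lambda>x. f x * \<phi> x)) \<and> dist_of_fun f \<in> hardy p"

definition bdd_cpt_supp :: "(real \<Rightarrow> complex) set" where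
  "bdd_cpt_supp = {f \<in> borel_measurable lebesgue.
     bounded (range f) \<and> compact (closure {x. f x \<noteq> 0})}"

definition frac_int :: "real \<Rightarrow> (real \<Rightarrow> complex) \<Rightarrow> (real \<Rightarrow> complex) \<Rightarrow> real \<Rightarrow> complex" where
  "frac_int \<gamma> f1 f2 x =
     (LINT (s, t)|lebesgue. f1 s * f2 t / complex_of_real ((\<bar>x - s\<bar> + \<bar>x - t\<bar>) powr (2 - \<gamma>)))"

text \<open>Boundedness from \<open>H\<^sup>p\<^sup>1 \<times> H\<^sup>p\<^sup>2\<close> into \<open>H\<^sup>q\<close>, with the quasi-norms computed using \<open>\<phi>\<close>.
  Membership in the spaces does not refer to \<open>\<phi>\<close>.\<close>

definition hardy_bounded ::
    "(real \<Rightarrow> complex) \<Rightarrow> ((real \<Rightarrow> complex) \<Rightarrow> (real \<Rightarrow> complex) \<Rightarrow> real \<Rightarrow> complex)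
      \<Rightarrow> real \<Rightarrow> real \<Rightarrow> real \<Rightarrow> bool" where
  "hardy_bounded \<phi> B p1 p2 q \<longleftrightarrow>
     (\<exists>C<\<infinity>. \<forall>f1\<in>bdd_cpt_supp. \<forall>f2\<in>bdd_cpt_supp.
        fun_in_hardy p1 f1 \<longrightarrow> fun_in_hardy p2 f2 \<longrightarrow>
          fun_in_hardy q (B f1 f2) \<and>
          hardy_qnorm \<phi> q (dist_of_fun (B f1 f2))
            \<le> C * hardy_qnorm \<phi> p1 (dist_of_fun f1) * hardy_qnorm \<phi> p2 (dist_of_fun f2))"

end

theory Submission
  imports Defs
begin

text \<open>
The condition \<open>p \<le> 1 / \<gamma>\<close> says exactly that \<open>q \<le> 1\<close>. An integrable function whose maximal function is
in \<open>L\<^sup>q\<close> for some \<open>q \<le> 1\<close> has integral zero, because otherwise its maximal function decays no faster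
than \<open>1 / \<bar>x\<bar>\<close> (lemma \<open>integral_eq_0_if_in_hardy\<close>). So it is enough to find admissible \<open>f1\<close> and \<open>f2\<close>
whose fractional integral is integrable with nonzero integral: the estimate then fails already because
the image does not lie in the target space, whatever the constant.

Integrating the kernel in \<open>x\<close> gives, after removal of a divergent constant, a multiple of
\<open>\<bar>s - t\<bar> powr (\<gamma> - 1)\<close>. If \<open>f1\<close> has mean zero the constant does not contribute, and the integral of the
fractional integral is \<open>(\<gamma> - 2) / (\<gamma> - 1)\<close> times the energy, that is, the double integral of
\<open>f1 s * f2 t * \<bar>s - t\<bar> powr (\<gamma> - 1)\<close> (lemma \<open>frac_int_integral\<close>). The exponent \<open>\<gamma> - 1\<close> lies strictly
between \<open>0\<close> and \<open>1\<close>, so the power is not a polynomial and vanishing moments of \<open>f1\<close> and \<open>f2\<close> do not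
annihilate it.

Concretely, \<open>f1\<close> is the first difference of one indicator function and \<open>f2\<close> the \<open>N\<close>-th difference of
another, with \<open>N\<close> large depending on \<open>p\<close>. Differences can be transferred to the Schwartz function in the
maximal function, where they act like derivatives; this yields the decay needed for membership in the
Hardy spaces (lemma \<open>fun_in_hardy_fdiff\<close>). They can equally be transferred to the power function,
whose iterated differences on the positive half-line have a strict sign (lemma
\<open>funpow_fdiff_powr_sign\<close>), so the energy is nonzero (lemma \<open>fdiff_energy_nonzero\<close>).
\<close>

section \<open>Finite differences\<close>

text \<open>Finite differences replace vanishing moments: the \<open>n\<close>-th difference of a function annihilates
  polynomials of degree below \<open>n\<close>, and translation of the variable of integration moves it onto the
  other factor of a convolution, even when it acts on an indicator function.\<close>

definition fdiff :: "(real \<Rightarrow> 'a::ab_group_add) \<Rightarrow> real \<Rightarrow> 'a" where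
  "fdiff f x = f (x + 1) - f x"

lemma funpow_fdiff_Suc: "(fdiff ^^ Suc n) f x = (fdiff ^^ n) f (x + 1) - (fdiff ^^ n) f x"
  unfolding funpow.simps o_def by (rule fdiff_def)

lemma funpow_fdiff_has_vector_derivative:
  fixes f f' :: "real \<Rightarrow> 'a::real_normed_vector"
  assumes S: "\<And>x. x \<in> S \<Longrightarrow> x + 1 \<in> S"
    and f: "\<And>x. x \<in> S \<Longrightarrow> (f has_vector_derivative f' x) (at x)"
    and "x \<in> S"
  shows "((fdiff ^^ n) f has_vector_derivative (fdiff ^^ n) f' x) (at x)"
  using \<open>x \<in> S\<close>
proof (induction n arbitrary: x)
  case 0
  then show ?case using f by simp
next
  case (Suc n)
  have "((\<lambda>x. (fdiff ^^ n) f (x + 1)) has_vector_derivative (fdiff ^^ n) f' (x + 1)) (at x)"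
    using vector_diff_chain_at[of "\<lambda>x. x + 1" 1 x "(fdiff ^^ n) f" "(fdiff ^^ n) f' (x + 1)"]
      Suc.IH[OF S[OF Suc.prems]] has_vector_derivative_add_const[of "\<lambda>x. x" 1 1]
    by (auto simp: o_def)
  from has_vector_derivative_diff[OF this Suc.IH[OF Suc.prems]]
  show ?case by (simp only: funpow_fdiff_Suc[abs_def])
qed

text \<open>By the mean value inequality each difference is controlled by one derivative on the interval that it
  spans. The family \<open>F\<close> lists the successive derivatives.\<close>

lemma norm_funpow_fdiff_le:
  fixes F :: "nat \<Rightarrow> real \<Rightarrow> 'a::real_inner"
  assumes F: "\<And>n x. (F n has_vector_derivative F (Suc n) x) (at x)"
    and B: "\<And>w. z \<le> w \<Longrightarrow> w \<le> z + real n \<Longrightarrow> norm (F (m + n) w) \<le> B"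
  shows "norm ((fdiff ^^ n) (F m) z) \<le> B"
  using B
proof (induction n arbitrary: m z)
  case 0
  then show ?case by simp
next
  case (Suc n)
  have D: "((fdiff ^^ n) (F m) has_vector_derivative (fdiff ^^ n) (F (Suc m)) x) (at x)" for x
    using funpow_fdiff_has_vector_derivative[of UNIV "F m" "F (Suc m)"] F by auto
  have "continuous_on {z..z+1} ((fdiff ^^ n) (F m))"
    using D by (meson continuous_at_imp_continuous_on has_vector_derivative_continuous)
  moreover have "((fdiff ^^ n) (F m) has_derivative (\<lambda>h. h *\<^sub>R (fdiff ^^ n) (F (Suc m)) x)) (at x)" for x
    using D[of x] by (simp add: has_vector_derivative_def)
  ultimately obtain x where x: "x \<in> {z<..<z+1}"
    "norm ((fdiff ^^ n) (F m) (z+1) - (fdiff ^^ n) (F m) z)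
      \<le> norm ((z + 1 - z) *\<^sub>R (fdiff ^^ n) (F (Suc m)) x)"
    using mvt_general[of z "z+1" "(fdiff ^^ n) (F m)" "\<lambda>x h. h *\<^sub>R (fdiff ^^ n) (F (Suc m)) x"]
    by auto
  have "norm ((fdiff ^^ n) (F (Suc m)) x) \<le> B"
    by (rule Suc.IH) (use Suc.prems x in auto)
  with x show ?case unfolding funpow_fdiff_Suc by simp
qed

lemma funpow_fdiff_cmult:
  fixes c :: "'a::ring"
  shows "(fdiff ^^ n) (\<lambda>x. c * f x) = (\<lambda>x. c * (fdiff ^^ n) f x)"
  by (induction n) (auto simp: fdiff_def[abs_def] algebra_simps)

lemma funpow_fdiff_of_real:
  "(fdiff ^^ n) (\<lambda>x. of_real (f x) :: 'a::real_algebra_1) = (\<lambda>x. of_real ((fdiff ^^ n) f x))"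
  by (induction n) (auto simp: fdiff_def[abs_def])

lemma funpow_fdiff_cong:
  assumes "\<And>x. x \<in> S \<Longrightarrow> x + 1 \<in> S" and "\<And>x. x \<in> S \<Longrightarrow> f x = g x" and "x \<in> S"
  shows "(fdiff ^^ n) f x = (fdiff ^^ n) g x"
  using assms(3) by (induction n arbitrary: x) (auto simp: fdiff_def assms)

lemma continuous_on_funpow_fdiff:
  fixes f :: "real \<Rightarrow> 'a::real_normed_vector"
  assumes "continuous_on UNIV f"
  shows "continuous_on UNIV ((fdiff ^^ n) f)"
proof (induction n)
  case (Suc n)
  have "continuous_on UNIV (\<lambda>x. (fdiff ^^ n) f (x + 1))"
    by (rule continuous_on_compose2[OF Suc]) (auto intro!: continuous_intros)
  then show ?case using Suc by (auto simp: fdiff_def[abs_def] intro!: continuous_intros)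
qed (use assms in simp)

text \<open>One difference becomes, by the mean value theorem, one derivative; for a power the derivative is a
  power again, which makes an induction on the number of differences possible.\<close>

lemma funpow_fdiff_powr_mvt:
  fixes b :: real
  assumes "x > 0"
  shows "\<exists>y>0. (fdiff ^^ Suc n) (\<lambda>u. u powr b) x = b * (fdiff ^^ n) (\<lambda>u. u powr (b - 1)) y"
proof -
  have "((fdiff ^^ n) (\<lambda>u. u powr b) has_vector_derivative (fdiff ^^ n) (\<lambda>u. b * u powr (b - 1)) y) (at y)"
    if "y > 0" for y
    by (rule funpow_fdiff_has_vector_derivative[where S = "{0<..}"])
       (use that in \<open>auto simp flip: has_real_derivative_iff_has_vector_derivative intro!: derivative_eq_intros\<close>)
  then have D: "((fdiff ^^ n) (\<lambda>u. u powr b) has_real_derivative b * (fdiff ^^ n) (\<lambda>u. u powr (b - 1)) y) (at y)"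
    if "y > 0" for y
    using that by (simp add: has_real_derivative_iff_has_vector_derivative funpow_fdiff_cmult)
  have "\<exists>y>x. y < x + 1 \<and> (fdiff ^^ n) (\<lambda>u. u powr b) (x+1) - (fdiff ^^ n) (\<lambda>u. u powr b) x
      = (x + 1 - x) * (b * (fdiff ^^ n) (\<lambda>u. u powr (b - 1)) y)"
    by (rule MVT2) (use D assms in auto)
  then show ?thesis using assms unfolding funpow_fdiff_Suc by (auto intro: less_trans)
qed

text \<open>Negative powers are completely monotone on the positive half-line, hence their iterated differences
  alternate in sign.\<close>

lemma funpow_fdiff_powr_neg:
  fixes b :: real
  assumes "b < 0" "x > 0"
  shows "(-1) ^ n * (fdiff ^^ n) (\<lambda>u. u powr b) x > 0"
  using assms
proof (induction n arbitrary: b x)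
  case 0
  then show ?case by simp
next
  case (Suc n)
  obtain y where y: "y > 0" "(fdiff ^^ Suc n) (\<lambda>u. u powr b) x = b * (fdiff ^^ n) (\<lambda>u. u powr (b - 1)) y"
    using funpow_fdiff_powr_mvt Suc.prems by blast
  have "(-b) * ((-1) ^ n * (fdiff ^^ n) (\<lambda>u. u powr (b - 1)) y) > 0"
    by (rule mult_pos_pos, use Suc.prems in simp, rule Suc.IH, use Suc.prems y in auto)
  then show ?case unfolding y(2) by (simp only: power_Suc mult_ac mult_minus_left mult_minus_right mult_1_left)
qed

text \<open>For an exponent strictly between \<open>0\<close> and \<open>1\<close> the first derivative is a positive multiple of a
  negative power, so from the first difference on the signs alternate and never vanish. This is what
  keeps any number of cancellations from killing the energy integral below.\<close>

lemma funpow_fdiff_powr_sign: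
  fixes a :: real
  assumes "0 < a" "a < 1" "x > 0"
  shows "(-1) ^ n * (fdiff ^^ Suc n) (\<lambda>u. \<bar>u\<bar> powr a) x > 0"
proof -
  have *: "(fdiff ^^ Suc n) (\<lambda>u. \<bar>u\<bar> powr a) x = (fdiff ^^ Suc n) (\<lambda>u. u powr a) x"
    by (rule funpow_fdiff_cong[where S = "{0<..}"]) (use assms in auto)
  obtain y where y: "y > 0" "(fdiff ^^ Suc n) (\<lambda>u. u powr a) x = a * (fdiff ^^ n) (\<lambda>u. u powr (a - 1)) y"
    using funpow_fdiff_powr_mvt assms by blast
  have "a * ((-1) ^ n * (fdiff ^^ n) (\<lambda>u. u powr (a - 1)) y) > 0"
    by (rule mult_pos_pos, use assms in simp, rule funpow_fdiff_powr_neg, use assms y in auto)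
  then show ?thesis unfolding * y(2) by (simp only: mult_ac)
qed

section \<open>Bounded Borel functions of compact support\<close>

lemma integrable_bounded_support:
  fixes F :: "'a::euclidean_space \<Rightarrow> 'b::{banach, second_countable_topology}"
  assumes [measurable]: "F \<in> borel_measurable borel"
    and "bounded S" and B: "\<And>x. norm (F x) \<le> B" and 0: "\<And>x. x \<notin> S \<Longrightarrow> F x = 0"
  shows "integrable lborel F"
proof -
  obtain c where c: "S \<subseteq> cbox (-c) c"
    using bounded_subset_cbox_symmetric[OF \<open>bounded S\<close>] by blast
  have "integrable lborel (\<lambda>x. B * indicator (cbox (-c) c) x)"
    by (intro integrable_mult_right integrable_real_indicator)
       (use emeasure_lborel_cbox_finite in \<open>auto simp: less_top\<close>)
  then show ?thesis
  proof (rule Bochner_Integration.integrable_bound)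
    show "AE x in lborel. norm (F x) \<le> norm (B * indicator (cbox (-c) c) x)"
    proof (rule AE_I2)
      fix x show "norm (F x) \<le> norm (B * indicator (cbox (-c) c) x)"
        using B[of x] 0[of x] c by (cases "x \<in> S") (auto simp: indicator_def abs_if)
    qed
  qed auto
qed

definition bdd_cpt_borel :: "(real \<Rightarrow> complex) \<Rightarrow> bool" where
  "bdd_cpt_borel g \<longleftrightarrow> g \<in> borel_measurable borel \<and> (\<exists>B. \<forall>x. norm (g x) \<le> B) \<and>
     (\<exists>R. \<forall>x. R < \<bar>x\<bar> \<longrightarrow> g x = 0)"

lemma bdd_cpt_borel_measurable: "bdd_cpt_borel g \<Longrightarrow> g \<in> borel_measurable borel"
  by (simp add: bdd_cpt_borel_def)

lemma bdd_cpt_borelE: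
  assumes "bdd_cpt_borel g"
  obtains B R where "B > 0" "R > 0" "\<And>x. norm (g x) \<le> B" "\<And>x. R < \<bar>x\<bar> \<Longrightarrow> g x = 0"
proof -
  obtain B R where "\<And>x. norm (g x) \<le> B" "\<And>x. R < \<bar>x\<bar> \<Longrightarrow> g x = 0"
    using assms unfolding bdd_cpt_borel_def by blast
  then show ?thesis by (intro that[of "max B 1" "max R 1"]) (auto simp: le_max_iff_disj)
qed

lemma bdd_cpt_borel_indicator: "bdd_cpt_borel (indicator {a..b})"
  unfolding bdd_cpt_borel_def
proof (intro conjI)
  show "\<exists>B. \<forall>x. norm (indicator {a..b} x :: complex) \<le> B"
    by (rule exI[of _ 1]) (auto simp: indicator_def)
  show "\<exists>R. \<forall>x. R < \<bar>x\<bar> \<longrightarrow> (indicator {a..b} x :: complex) = 0"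
    by (rule exI[of _ "max \<bar>a\<bar> \<bar>b\<bar>"]) (auto simp: indicator_def)
qed auto

lemma bdd_cpt_borel_fdiff:
  assumes "bdd_cpt_borel g"
  shows "bdd_cpt_borel (fdiff g)"
proof -
  have [measurable]: "g \<in> borel_measurable borel" using assms by (rule bdd_cpt_borel_measurable)
  obtain B R where "B > 0" "R > 0" and B: "\<And>x. norm (g x) \<le> B" and R: "\<And>x. R < \<bar>x\<bar> \<Longrightarrow> g x = 0"
    using assms by (rule bdd_cpt_borelE) blast
  have "norm (fdiff g x) \<le> 2 * B" for x
    using norm_triangle_ineq4[of "g (x+1)" "g x"] B[of x] B[of "x+1"] by (simp add: fdiff_def)
  moreover have "fdiff g x = 0" if "R + 1 < \<bar>x\<bar>" for x
    using R[of x] R[of "x+1"] that by (simp add: fdiff_def)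
  moreover have "fdiff g \<in> borel_measurable borel" unfolding fdiff_def[abs_def] by measurable
  ultimately show ?thesis unfolding bdd_cpt_borel_def by blast
qed

lemma bdd_cpt_borel_funpow_fdiff:
  "bdd_cpt_borel g \<Longrightarrow> bdd_cpt_borel ((fdiff ^^ n) g)"
  by (induction n) (auto intro: bdd_cpt_borel_fdiff)

lemma integrable_bdd_cpt_mult:
  assumes g: "bdd_cpt_borel g" and \<psi>: "continuous_on UNIV \<psi>"
  shows "integrable lborel (\<lambda>y. g y * \<psi> y :: complex)"
proof -
  have [measurable]: "g \<in> borel_measurable borel" using g by (rule bdd_cpt_borel_measurable)
  have [measurable]: "\<psi> \<in> borel_measurable borel" using \<psi> by (rule borel_measurable_continuous_onI)
  obtain B R where B: "B > 0" and "R > 0" and B': "\<And>x. norm (g x) \<le> B" and R: "\<And>x. R < \<bar>x\<bar> \<Longrightarrow> g x = 0"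
    using g by (rule bdd_cpt_borelE) blast
  have "compact (\<psi> ` {-R..R})"
    by (intro compact_continuous_image continuous_on_subset[OF \<psi>]) auto
  then obtain D where D: "D > 0" "\<And>x. x \<in> {-R..R} \<Longrightarrow> norm (\<psi> x) \<le> D"
    using bounded_pos compact_imp_bounded by (metis imageI)
  show ?thesis
  proof (rule integrable_bounded_support[where S = "{-R..R}" and B = "B * D"])
    show "norm (g y * \<psi> y) \<le> B * D" for y
    proof (cases "y \<in> {-R..R}")
      case True
      then show ?thesis using B B' D unfolding norm_mult by (intro mult_mono) auto
    next
      case False
      then show ?thesis using R[of y] B D by auto
    qed
  qed (use R in auto)
qed

text \<open>Summation by parts: translating the variable of integration moves one shift, hence one difference,
  from \<open>g\<close> to \<open>\<psi>\<close>. The sign is unchanged because \<open>\<psi>\<close> is evaluated at \<open>x - y\<close>.\<close>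

lemma integral_funpow_fdiff_mult:
  assumes g: "bdd_cpt_borel g" and \<psi>: "continuous_on UNIV (\<psi> :: real \<Rightarrow> complex)"
  shows "(LINT y|lborel. (fdiff ^^ n) g y * \<psi> (x - y)) = (LINT y|lborel. g y * (fdiff ^^ n) \<psi> (x - y))"
  using g
proof (induction n arbitrary: g)
  case 0
  then show ?case by simp
next
  case (Suc n)
  define \<theta> where "\<theta> = (fdiff ^^ n) \<psi>"
  have c: "continuous_on UNIV \<theta>" unfolding \<theta>_def by (rule continuous_on_funpow_fdiff[OF \<psi>])
  have c': "continuous_on UNIV (\<lambda>y. \<theta> (c - y))" for c
    by (rule continuous_on_compose2[OF c]) (auto intro!: continuous_intros)
  have i: "integrable lborel (\<lambda>y. g y * \<theta> (c - y))" for c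
    by (rule integrable_bdd_cpt_mult[OF Suc.prems c'])
  have shift: "integrable lborel (\<lambda>y. g (y + 1) * \<theta> (x - y))"
    "(LINT y|lborel. g (y + 1) * \<theta> (x - y)) = (LINT y|lborel. g y * \<theta> (x + 1 - y))"
    using lborel_integrable_real_affine[OF i[of "x+1"], of 1 1]
      lborel_integral_real_affine[of 1 "\<lambda>y. g y * \<theta> (x + 1 - y)" 1]
    by (simp_all add: add.commute)
  have "(LINT y|lborel. (fdiff ^^ Suc n) g y * \<psi> (x - y)) = (LINT y|lborel. fdiff g y * \<theta> (x - y))"
    using Suc.IH[OF bdd_cpt_borel_fdiff[OF Suc.prems]]
    unfolding \<theta>_def by (simp add: funpow_Suc_right del: funpow.simps)
  also have "\<dots> = (LINT y|lborel. g (y + 1) * \<theta> (x - y) - g y * \<theta> (x - y))"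
    by (simp add: fdiff_def algebra_simps)
  also have "\<dots> = (LINT y|lborel. g y * \<theta> (x + 1 - y)) - (LINT y|lborel. g y * \<theta> (x - y))"
    using shift i by (subst Bochner_Integration.integral_diff) auto
  also have "\<dots> = (LINT y|lborel. g y * \<theta> (x + 1 - y) - g y * \<theta> (x - y))"
    using i by (subst Bochner_Integration.integral_diff) auto
  also have "\<dots> = (LINT y|lborel. g y * (fdiff ^^ Suc n) \<psi> (x - y))"
    unfolding funpow.simps o_def \<theta>_def[symmetric] fdiff_def
    by (intro Bochner_Integration.integral_cong) (auto simp: algebra_simps)
  finally show ?case .
qed

section \<open>Integrable elements of the Hardy space have mean zero\<close>

lemma schwartz_has_vector_derivative:
  assumes "\<phi> \<in> schwartz"
  shows "(iter_deriv n \<phi> has_vector_derivative iter_deriv (Suc n) \<phi> x) (at x)"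
  using assms by (simp add: schwartz_def iter_deriv_def vector_derivative_works)

lemma schwartz_continuous:
  assumes "\<phi> \<in> schwartz"
  shows "continuous_on UNIV \<phi>"
  using schwartz_has_vector_derivative[OF assms, of 0]
  by (auto simp: iter_deriv_def intro!: continuous_at_imp_continuous_on
      dest: has_vector_derivative_continuous)

lemma schwartz_borel: "\<phi> \<in> schwartz \<Longrightarrow> \<phi> \<in> borel_measurable borel"
  by (intro borel_measurable_continuous_onI schwartz_continuous)

lemma schwartz_decay:
  assumes "\<phi> \<in> schwartz"
  obtains C where "C > 0" "\<And>x. \<bar>x\<bar> ^ k * norm (iter_deriv n \<phi> x) \<le> C"
proof -
  have "bounded (range (\<lambda>x. x ^ k *\<^sub>R iter_deriv n \<phi> x))"
    using assms by (simp add: schwartz_def)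
  then obtain C where "C > 0" "\<And>x. norm (x ^ k *\<^sub>R iter_deriv n \<phi> x) \<le> C"
    by (auto simp: bounded_pos)
  then show ?thesis by (intro that[of C]) (auto simp: power_abs)
qed

lemma lebesgue_integral_lborel:
  fixes f :: "'a::euclidean_space \<Rightarrow> 'b::{banach, second_countable_topology}"
  assumes "f \<in> borel_measurable borel"
  shows "integral\<^sup>L lebesgue f = integral\<^sup>L lborel f"
  using assms by (intro integral_completion) simp

lemma epowr_mono_real:
  assumes "a \<le> ennreal b" "0 < r" "0 \<le> b"
  shows "epowr a r \<le> ennreal (b powr r)"
proof -
  have "a < \<infinity>" using assms(1) by (simp add: order_le_less_trans[OF _ ennreal_less_top])
  moreover have "enn2real a \<le> b"
    using assms by (simp add: enn2real_leI)
  ultimately show ?thesis using assms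
    by (auto simp: epowr_def intro!: ennreal_leI powr_mono2)
qed

lemma epowr_ge_real:
  assumes "ennreal b \<le> a" "0 < r" "0 \<le> b"
  shows "ennreal (b powr r) \<le> epowr a r"
proof (cases "a = \<infinity>")
  case False
  then have "b \<le> enn2real a"
    using assms by (metis enn2real_ennreal enn2real_mono infinity_ennreal_def less_top)
  then show ?thesis using assms False
    by (auto simp: epowr_def intro!: ennreal_leI powr_mono2)
qed (simp add: epowr_def)

lemma dist_of_fun_lborel:
  assumes [measurable]: "f \<in> borel_measurable borel" and "\<psi> \<in> borel_measurable borel"
  shows "dist_of_fun f \<psi> = (LINT y|lborel. f y * \<psi> y)"
  unfolding dist_of_fun_def using assms(2) by (intro lebesgue_integral_lborel) measurable

lemma conv_dist_dist_of_fun: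
  assumes [measurable]: "f \<in> borel_measurable borel" "\<phi> \<in> borel_measurable borel"
  shows "conv_dist (dilate \<phi> t) (dist_of_fun f) x = (LINT y|lborel. f y * dilate \<phi> t (x - y))"
  unfolding conv_dist_def by (intro dist_of_fun_lborel) (auto simp: dilate_def[abs_def])

lemma nn_integral_inverse_at_top:
  assumes "T > 0" "c > 0"
  shows "(\<integral>\<^sup>+t. ennreal (c / t) * indicator {T..} t \<partial>lborel) = \<infinity>"
proof -
  have ge: "ennreal (c * real n) \<le> (\<integral>\<^sup>+t. ennreal (c / t) * indicator {T..} t \<partial>lborel)" for n
  proof -
    have pos: "t > 0" if "T \<le> t" for t using that assms by simp
    have "(\<integral>\<^sup>+t. ennreal (c / t) * indicator {T..T * exp (real n)} t \<partial>lborel)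
        = c * ln (T * exp (real n)) - c * ln T"
    proof (rule nn_integral_FTC_Icc)
      show "((\<lambda>t. c * ln t) has_real_derivative c / t) (at t)" if "t \<in> {T..T * exp (real n)}" for t
        using pos[of t] that by (auto intro!: derivative_eq_intros)
      show "0 \<le> c / t" if "t \<in> {T..T * exp (real n)}" for t using pos[of t] that assms by simp
      show "T \<le> T * exp (real n)" using assms by simp
    qed measurable
    also have "c * ln (T * exp (real n)) - c * ln T = c * real n"
      using assms by (simp add: ln_mult algebra_simps)
    finally have "ennreal (c * real n) = (\<integral>\<^sup>+t. ennreal (c / t) * indicator {T..T * exp (real n)} t \<partial>lborel)"
      by simp
    also have "\<dots> \<le> (\<integral>\<^sup>+t. ennreal (c / t) * indicator {T..} t \<partial>lborel)"
      by (intro nn_integral_mono) (auto simp: indicator_def)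
    finally show ?thesis .
  qed
  show ?thesis
  proof (rule ccontr)
    assume "\<not> ?thesis"
    then obtain r where r: "r \<ge> 0" "(\<integral>\<^sup>+t. ennreal (c / t) * indicator {T..} t \<partial>lborel) = ennreal r"
      by (metis ennreal_cases infinity_ennreal_def)
    obtain n where "r / c < real n" using reals_Archimedean2 by blast
    then have "r < c * real n" using assms by (simp add: field_simps)
    then show False using ge[of n] r assms by simp
  qed
qed

lemma nonzero_value_of_integral_1:
  assumes "integral\<^sup>L lebesgue \<phi> = (1::complex)"
  shows "\<exists>a\<noteq>0. \<phi> (a::real) \<noteq> 0"
proof (rule ccontr)
  assume "\<not> ?thesis"
  moreover have "AE x in lebesgue. x \<noteq> (0::real)"
    using AE_completion[OF AE_lborel_singleton[of "0::real"]] by simp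
  ultimately have "AE x in lebesgue. \<phi> x = 0" by (auto elim: eventually_mono)
  then have "integral\<^sup>L lebesgue \<phi> = 0" by (rule integral_eq_zero_AE)
  with assms show False by simp
qed

text \<open>Let \<open>\<phi> a \<noteq> 0\<close> with \<open>a \<noteq> 0\<close>. At the point \<open>x = a * t\<close> the convolution with \<open>\<phi>\<^sub>t\<close> equals \<open>1 / t\<close>
  times the integral of \<open>F y * \<phi> (a - y / t)\<close>, which tends to \<open>\<phi> a\<close> times the integral of \<open>F\<close>.
  If the latter is nonzero, the maximal function is at least a multiple of \<open>1 / \<bar>x\<bar>\<close> near infinity on
  one half-line, and its \<open>q\<close>-th power has infinite integral as \<open>q \<le> 1\<close>.\<close>

lemma integral_eq_0_if_in_hardy:
  fixes F :: "real \<Rightarrow> complex"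
  assumes F: "integrable lborel F" and q: "0 < q" "q \<le> 1" and H: "dist_of_fun F \<in> hardy q"
  shows "integral\<^sup>L lborel F = 0"
proof (rule ccontr)
  assume nz: "integral\<^sup>L lborel F \<noteq> 0"
  have [measurable]: "F \<in> borel_measurable borel" using F by auto
  obtain \<phi> where \<phi>: "\<phi> \<in> schwartz" "integral\<^sup>L lebesgue \<phi> = 1"
      and fin: "hardy_qnorm \<phi> q (dist_of_fun F) < \<infinity>"
    using H unfolding hardy_def by blast
  have [measurable]: "\<phi> \<in> borel_measurable borel" using \<phi>(1) by (rule schwartz_borel)
  obtain a where a: "a \<noteq> 0" "\<phi> a \<noteq> 0" using nonzero_value_of_integral_1[OF \<phi>(2)] by blast
  obtain B where B: "B > 0" "\<And>x. norm (\<phi> x) \<le> B"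
    using schwartz_decay[OF \<phi>(1), of 0 0] by (auto simp: iter_deriv_def)
  define G where "G t = (LINT y|lborel. F y * \<phi> (a - y / t))" for t
  have cont: "isCont \<phi> a" using schwartz_continuous[OF \<phi>(1)] by (simp add: continuous_on_eq_continuous_at)
  have "(G \<longlongrightarrow> (LINT y|lborel. F y * \<phi> a)) at_top"
    unfolding G_def
  proof (rule integral_dominated_convergence_at_top[where w = "\<lambda>y. norm (F y) * B"])
    show "\<forall>\<^sub>F t in at_top. AE y in lborel. norm (F y * \<phi> (a - y / t)) \<le> norm (F y) * B"
      using B by (intro always_eventually allI AE_I2) (auto simp: norm_mult intro!: mult_left_mono)
    show "AE y in lborel. ((\<lambda>t. F y * \<phi> (a - y / t)) \<longlongrightarrow> F y * \<phi> a) at_top"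
    proof (rule AE_I2)
      fix y :: real
      have "((\<lambda>t. a - y / t) \<longlongrightarrow> a - 0) at_top"
        by (intro tendsto_intros tendsto_divide_0[OF tendsto_const] filterlim_at_top_imp_at_infinity filterlim_ident)
      then have "((\<lambda>t. \<phi> (a - y / t)) \<longlongrightarrow> \<phi> a) at_top"
        using isCont_tendsto_compose[OF cont] by simp
      then show "((\<lambda>t. F y * \<phi> (a - y / t)) \<longlongrightarrow> F y * \<phi> a) at_top"
        by (intro tendsto_intros)
    qed
  qed (use F in auto)
  then have lim: "((\<lambda>t. norm (G t)) \<longlongrightarrow> norm (integral\<^sup>L lborel F * \<phi> a)) at_top"
    by (intro tendsto_norm) simp
  define \<delta> where "\<delta> = norm (integral\<^sup>L lborel F * \<phi> a) / 2"
  have \<delta>: "\<delta> > 0" using nz a by (simp add: \<delta>_def)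
  have "\<forall>\<^sub>F t in at_top. norm (G t) > \<delta>"
    using order_tendstoD(1)[OF lim, of \<delta>] \<delta> unfolding \<delta>_def by simp
  then obtain T where T: "T \<ge> 1" "\<And>t. t \<ge> T \<Longrightarrow> norm (G t) > \<delta>"
    unfolding eventually_at_top_linorder by (metis max.bounded_iff max.cobounded1)
  \<comment> \<open>A Borel minorant of the \<open>q\<close>-th power of the maximal function; \<open>T \<ge> 1\<close> gives \<open>t powr q \<le> t\<close>.\<close>
  define h where "h t = ennreal (\<delta> powr q / t) * indicator {T..} t" for t
  have le: "h (x / a) \<le> epowr (maximal_fn \<phi> (dist_of_fun F) x) q" for x
  proof (cases "x / a \<ge> T")
    case True
    define t where "t = x / a"
    have t: "t \<ge> T" "t \<ge> 1" "x = a * t" using True T(1) a by (auto simp: t_def)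
    have "conv_dist (dilate \<phi> t) (dist_of_fun F) x = complex_of_real (1 / t) * G t"
      unfolding G_def conv_dist_dist_of_fun[OF \<open>F \<in> borel_measurable borel\<close> \<open>\<phi> \<in> borel_measurable borel\<close>]
        integral_mult_right_zero[symmetric]
      by (intro Bochner_Integration.integral_cong) (use t in \<open>auto simp: dilate_def diff_divide_distrib\<close>)
    then have "norm (conv_dist (dilate \<phi> t) (dist_of_fun F) x) = norm (G t) / t"
      using t(2) by (simp only:) (simp add: norm_mult norm_divide)
    then have "\<delta> / t \<le> norm (conv_dist (dilate \<phi> t) (dist_of_fun F) x)"
      using T(2)[OF t(1)] t(2) by (simp add: divide_right_mono)
    then have "ennreal (\<delta> / t) \<le> ennreal (norm (conv_dist (dilate \<phi> t) (dist_of_fun F) x))"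
      by (rule ennreal_leI)
    also have "\<dots> \<le> maximal_fn \<phi> (dist_of_fun F) x"
      unfolding maximal_fn_def by (intro SUP_upper) (use t in auto)
    finally have "ennreal ((\<delta> / t) powr q) \<le> epowr (maximal_fn \<phi> (dist_of_fun F) x) q"
      using \<delta> t q by (intro epowr_ge_real) auto
    moreover have "t powr q \<le> t" using powr_mono[of q 1 t] q t by simp
    then have "\<delta> powr q / t \<le> (\<delta> / t) powr q"
      using \<delta> t by (simp add: powr_divide divide_left_mono)
    then have "h t \<le> ennreal ((\<delta> / t) powr q)" using t by (simp add: h_def ennreal_leI)
    ultimately show ?thesis unfolding t_def by (rule order_trans[rotated])
  qed (simp add: h_def)
  have [measurable]: "h \<in> borel_measurable borel" unfolding h_def[abs_def] by measurable
  have "(\<integral>\<^sup>+x. h (x / a) \<partial>lborel) = \<bar>a\<bar> * (\<integral>\<^sup>+x. h x \<partial>lborel)"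
    using nn_integral_real_affine[of "\<lambda>x. h (x / a)" a 0] a by simp
  also have "\<dots> = \<infinity>"
    using nn_integral_inverse_at_top[of T "\<delta> powr q"] T(1) \<delta> a unfolding h_def
    by (simp add: ennreal_mult_top)
  finally have "(\<integral>\<^sup>+x. epowr (maximal_fn \<phi> (dist_of_fun F) x) q \<partial>lebesgue) = \<infinity>"
    using nn_integral_mono[of lebesgue "\<lambda>x. h (x / a)", OF le]
    by (simp add: nn_integral_completion top_unique)
  then show False using fin by (simp add: hardy_qnorm_def Lp_qnorm_def epowr_def)
qed

section \<open>Iterated differences lie in the Hardy space\<close>

lemma integrable_powr_decay:
  fixes r :: real
  assumes "r > 1"
  shows "integrable lborel (\<lambda>x::real. (1 + \<bar>x\<bar>) powr (-r))"
proof -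
  define g where "g x = (1 + x) powr (-r) * indicator {0..} x" for x :: real
  have [measurable]: "g \<in> borel_measurable borel" unfolding g_def[abs_def] by measurable
  have "(\<integral>\<^sup>+x. ennreal ((1 + x) powr (-r)) * indicator {0..} x \<partial>lborel)
      = 0 - (1 + 0) powr (1 - r) / (1 - r)"
  proof (rule nn_integral_FTC_atLeast)
    show "DERIV (\<lambda>x. (1 + x) powr (1 - r) / (1 - r)) x :> (1 + x) powr (-r)" if "0 \<le> x" for x :: real
      using that assms by (auto intro!: derivative_eq_intros)
    have "filterlim (\<lambda>x::real. 1 + x) at_top at_top"
      by (intro filterlim_tendsto_add_at_top[OF tendsto_const] filterlim_ident)
    then have "((\<lambda>x. (1 + x) powr (1 - r)) \<longlongrightarrow> 0) at_top"
      using assms by (intro tendsto_neg_powr) auto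
    then show "((\<lambda>x. (1 + x) powr (1 - r) / (1 - r)) \<longlongrightarrow> 0) at_top"
      by (rule tendsto_divide_zero)
  qed auto
  moreover have "ennreal (norm (g x)) = ennreal ((1 + x) powr (-r)) * indicator {0..} x" for x
    by (simp add: g_def indicator_def)
  ultimately have i: "integrable lborel g"
    by (intro integrableI_bounded) (auto simp: less_top)
  have "integrable lborel (\<lambda>x. g x + g (- x))"
    using i lborel_integrable_real_affine[OF i, of "-1" 0] by (intro Bochner_Integration.integrable_add) auto
  then show ?thesis
    by (rule Bochner_Integration.integrable_bound) (auto intro!: AE_I2 simp: g_def indicator_def)
qed

lemma dist_of_fun_tempered:
  assumes "bdd_cpt_borel f"
  shows "dist_of_fun f \<in> tempered"
proof -
  have [measurable]: "f \<in> borel_measurable borel" using assms by (rule bdd_cpt_borel_measurable)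
  have i: "integrable lborel (\<lambda>x. f x * \<phi> x)" if "\<phi> \<in> schwartz" for \<phi>
    by (rule integrable_bdd_cpt_mult[OF assms schwartz_continuous[OF that]])
  have f: "integrable lborel f"
    using integrable_bdd_cpt_mult[OF assms, of "\<lambda>_. 1"] by simp
  have eq: "dist_of_fun f \<phi> = (LINT x|lborel. f x * \<phi> x)" if "\<phi> \<in> borel_measurable borel" for \<phi>
    by (rule dist_of_fun_lborel) (use that in auto)
  have "norm (dist_of_fun f \<phi>) \<le> (LINT x|lborel. norm (f x)) * (\<Sum>k\<le>0. \<Sum>n\<le>0. schwartz_seminorm k n \<phi>)"
    if \<phi>: "\<phi> \<in> schwartz" for \<phi>
  proof -
    obtain C where "\<And>x. norm (\<phi> x) \<le> C"
      using schwartz_decay[OF \<phi>, of 0 0] by (auto simp: iter_deriv_def)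
    then have S: "norm (\<phi> x) \<le> schwartz_seminorm 0 0 \<phi>" for x
      unfolding schwartz_seminorm_def iter_deriv_def by (auto intro!: cSUP_upper2 bdd_aboveI2)
    have "norm (dist_of_fun f \<phi>) \<le> (LINT x|lborel. norm (f x * \<phi> x))"
      unfolding eq[OF schwartz_borel[OF \<phi>]] by (rule integral_norm_bound)
    also have "\<dots> \<le> (LINT x|lborel. norm (f x) * schwartz_seminorm 0 0 \<phi>)"
      using integrable_norm[OF i[OF \<phi>]] f S
      by (intro integral_mono) (auto simp: norm_mult intro!: mult_left_mono)
    finally show ?thesis by simp
  qed
  then have "\<exists>C N. \<forall>\<phi>\<in>schwartz. norm (dist_of_fun f \<phi>) \<le> C * (\<Sum>k\<le>N. \<Sum>n\<le>N. schwartz_seminorm k n \<phi>)"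
    by blast
  moreover have "dist_of_fun f (\<lambda>x. \<phi> x + \<psi> x) = dist_of_fun f \<phi> + dist_of_fun f \<psi>"
    if "\<phi> \<in> schwartz" "\<psi> \<in> schwartz" for \<phi> \<psi>
    using i that by (simp add: eq borel_measurable_add schwartz_borel distrib_left)
  moreover have "dist_of_fun f (\<lambda>x. c * \<phi> x) = c * dist_of_fun f \<phi>" if "\<phi> \<in> schwartz" for \<phi> c
    using that by (simp add: eq borel_measurable_times schwartz_borel mult.left_commute)
  ultimately show ?thesis unfolding tempered_def by blast
qed

text \<open>The convolution of \<open>\<phi>\<^sub>t\<close> with the \<open>N\<close>-th difference of \<open>g\<close> is the convolution of \<open>g\<close> with the \<open>N\<close>-th
  difference of \<open>\<phi>\<^sub>t\<close>. The \<open>N\<close>-th derivative of \<open>\<phi>\<^sub>t\<close> at \<open>w\<close> is \<open>t\<close> to the power \<open>- (N + 1)\<close> times that of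
  \<open>\<phi>\<close> at \<open>w / t\<close>, so the decay of a Schwartz function of order \<open>N + 1\<close> exactly cancels the powers
  of \<open>t\<close> and leaves a bound independent of \<open>t\<close>. Near the support the trivial bound by the integral of
  \<open>\<bar>\<phi>\<bar>\<close> suffices.\<close>

lemma conv_dist_fdiff_decay:
  assumes \<phi>: "\<phi> \<in> schwartz" "integral\<^sup>L lebesgue \<phi> = 1" and g: "bdd_cpt_borel g"
  obtains K where "K \<ge> 0" "\<And>t x. t > 0 \<Longrightarrow>
      norm (conv_dist (dilate \<phi> t) (dist_of_fun ((fdiff ^^ N) g)) x) \<le> K * (1 + \<bar>x\<bar>) powr (- real (Suc N))"
proof -
  define f where "f = (fdiff ^^ N) g"
  have f: "bdd_cpt_borel f" unfolding f_def by (rule bdd_cpt_borel_funpow_fdiff[OF g])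
  note [measurable] = bdd_cpt_borel_measurable[OF f] bdd_cpt_borel_measurable[OF g] schwartz_borel[OF \<phi>(1)]
  obtain Bf where Bf: "Bf > 0" "\<And>x. norm (f x) \<le> Bf" using f by (rule bdd_cpt_borelE) blast
  obtain R where R: "R > 0" "\<And>x. R < \<bar>x\<bar> \<Longrightarrow> g x = 0" using g by (rule bdd_cpt_borelE) blast
  have ig: "integrable lborel g"
    using integrable_bdd_cpt_mult[OF g, of "\<lambda>_. 1"] by simp
  obtain C where C: "C > 0" "\<And>x. \<bar>x\<bar> ^ Suc N * norm (iter_deriv N \<phi> x) \<le> C"
    using schwartz_decay[OF \<phi>(1), of "Suc N" N] by blast
  define L where "L = (LINT y|lborel. norm (\<phi> y))"
  define M where "M = (LINT y|lborel. norm (g y))"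
  have LM: "L \<ge> 0" "M \<ge> 0" by (auto simp: L_def M_def)
  have "integrable lebesgue \<phi>" using \<phi>(2) not_integrable_integral_eq by fastforce
  then have i\<phi>: "integrable lborel \<phi>" by (simp add: integrable_completion)
  have cd: "continuous_on UNIV (dilate \<phi> t)" if "t > 0" for t
    unfolding dilate_def[abs_def]
    using that by (auto intro!: continuous_intros continuous_on_compose2[OF schwartz_continuous[OF \<phi>(1)]])
  \<comment> \<open>Beyond \<open>X\<close>, every point used by the differences at \<open>x - y\<close> with \<open>\<bar>y\<bar> \<le> R\<close> has modulus at least \<open>\<bar>x\<bar> / 2\<close>.\<close>
  define X where "X = 2 * R + 2 * real N + 1"
  have X: "X \<ge> 1" using R by (simp add: X_def)
  have conv: "conv_dist (dilate \<phi> t) (dist_of_fun f) x = (LINT y|lborel. f y * dilate \<phi> t (x - y))" for t x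
    by (rule conv_dist_dist_of_fun) measurable
  have near: "norm (conv_dist (dilate \<phi> t) (dist_of_fun f) x) \<le> Bf * L" if t: "t > 0" for t x
  proof -
    have *: "integrable lborel (\<lambda>y. norm (dilate \<phi> t (x - y)))"
      "(LINT y|lborel. norm (dilate \<phi> t (x - y))) = L"
      using lborel_integrable_real_affine[OF integrable_norm[OF i\<phi>], of "-1/t" "x/t"]
        lborel_integral_real_affine[of "-1/t" "\<lambda>y. norm (\<phi> y)" "x/t"] t
      by (auto simp: dilate_def[abs_def] norm_mult norm_divide L_def diff_divide_distrib)
    have "norm (conv_dist (dilate \<phi> t) (dist_of_fun f) x) \<le> (LINT y|lborel. norm (f y * dilate \<phi> t (x - y)))"
      unfolding conv by (rule integral_norm_bound)
    also have "\<dots> \<le> (LINT y|lborel. Bf * norm (dilate \<phi> t (x - y)))"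
    proof (rule integral_mono)
      show "integrable lborel (\<lambda>y. norm (f y * dilate \<phi> t (x - y)))"
        by (intro integrable_norm integrable_bdd_cpt_mult[OF f] continuous_on_compose2[OF cd[OF t]] continuous_intros) auto
    qed (use * Bf in \<open>auto simp: norm_mult intro!: mult_right_mono\<close>)
    finally show ?thesis using * by simp
  qed
  have far: "norm (conv_dist (dilate \<phi> t) (dist_of_fun f) x) \<le> M * (C * (2 / \<bar>x\<bar>) ^ Suc N)"
    if t: "t > 0" and x: "\<bar>x\<bar> > X" for t x
  proof -
    \<comment> \<open>\<open>F n\<close> is the \<open>n\<close>-th derivative of \<open>\<phi>\<^sub>t\<close>.\<close>
    define F where "F n z = complex_of_real (1 / t ^ Suc n) * iter_deriv n \<phi> (z / t)" for n z
    have F0: "F 0 = dilate \<phi> t" by (simp add: F_def[abs_def] dilate_def[abs_def] iter_deriv_def)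
    have DF: "(F n has_vector_derivative F (Suc n) z) (at z)" for n z
    proof -
      have "((\<lambda>z. z / t) has_vector_derivative 1 / t) (at z)"
        unfolding has_real_derivative_iff_has_vector_derivative[symmetric]
        using t by (auto intro!: derivative_eq_intros)
      from vector_diff_chain_at[OF this schwartz_has_vector_derivative[OF \<phi>(1)]]
      have "((\<lambda>z. iter_deriv n \<phi> (z / t)) has_vector_derivative (1 / t) *\<^sub>R iter_deriv (Suc n) \<phi> (z / t)) (at z)"
        by (simp add: o_def)
      from has_vector_derivative_mult_right[OF this, of "complex_of_real (1 / t ^ Suc n)"]
      show ?thesis unfolding F_def[abs_def] by (simp add: scaleR_conv_of_real mult_ac)
    qed
    have b: "norm ((fdiff ^^ N) (dilate \<phi> t) (x - y)) \<le> C * (2 / \<bar>x\<bar>) ^ Suc N" if y: "\<bar>y\<bar> \<le> R" for y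
    proof -
      have "norm ((fdiff ^^ N) (F 0) (x - y)) \<le> C * (2 / \<bar>x\<bar>) ^ Suc N"
      proof (rule norm_funpow_fdiff_le[of F])
        show "(F n has_vector_derivative F (Suc n) z) (at z)" for n z by (rule DF)
        fix w assume w: "x - y \<le> w" "w \<le> x - y + real N"
        have w2: "\<bar>w\<bar> \<ge> \<bar>x\<bar> / 2" using w y x unfolding X_def by linarith
        have x0: "\<bar>x\<bar> > 0" using x X by linarith
        have "norm (F N w) * \<bar>w\<bar> ^ Suc N = \<bar>w / t\<bar> ^ Suc N * norm (iter_deriv N \<phi> (w / t))"
          unfolding F_def norm_mult norm_of_real using t by (simp add: power_divide abs_divide mult_ac)
        also have "\<dots> \<le> C" by (rule C)
        finally have *: "norm (F N w) * \<bar>w\<bar> ^ Suc N \<le> C" .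
        have "norm (F N w) * (\<bar>x\<bar> / 2) ^ Suc N \<le> norm (F N w) * \<bar>w\<bar> ^ Suc N"
          using w2 by (intro mult_left_mono power_mono) auto
        with * have "norm (F N w) * (\<bar>x\<bar> / 2) ^ Suc N \<le> C" by linarith
        then have "norm (F N w) \<le> C / (\<bar>x\<bar> / 2) ^ Suc N"
          using x0 by (subst pos_le_divide_eq) auto
        then show "norm (F (0 + N) w) \<le> C * (2 / \<bar>x\<bar>) ^ Suc N"
          by (simp only: power_divide divide_divide_eq_right times_divide_eq_right add_0)
      qed
      then show ?thesis by (simp add: F0)
    qed
    have cx: "continuous_on UNIV (\<lambda>y. (fdiff ^^ N) (dilate \<phi> t) (x - y))"
      by (intro continuous_on_compose2[OF continuous_on_funpow_fdiff[OF cd[OF t]]] continuous_intros) auto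
    have "conv_dist (dilate \<phi> t) (dist_of_fun f) x = (LINT y|lborel. g y * (fdiff ^^ N) (dilate \<phi> t) (x - y))"
      unfolding conv by (unfold f_def, rule integral_funpow_fdiff_mult[OF g cd[OF t]])
    also have "norm \<dots> \<le> (LINT y|lborel. norm (g y * (fdiff ^^ N) (dilate \<phi> t) (x - y)))"
      by (rule integral_norm_bound)
    also have "\<dots> \<le> (LINT y|lborel. norm (g y) * (C * (2 / \<bar>x\<bar>) ^ Suc N))"
    proof (rule integral_mono)
      show "norm (g y * (fdiff ^^ N) (dilate \<phi> t) (x - y)) \<le> norm (g y) * (C * (2 / \<bar>x\<bar>) ^ Suc N)" for y
        unfolding norm_mult
        by (cases "\<bar>y\<bar> \<le> R") (use R b[of y] in \<open>auto intro!: mult_left_mono simp del: power_Suc\<close>)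
    qed (use ig in \<open>auto intro!: integrable_norm integrable_bdd_cpt_mult[OF g cx] integrable_mult_left simp del: power_Suc\<close>)
    also have "\<dots> = M * (C * (2 / \<bar>x\<bar>) ^ Suc N)" unfolding M_def by (simp del: power_Suc)
    finally show ?thesis .
  qed
  define K where "K = Bf * L * (1 + X) ^ Suc N + M * (C * 4 ^ Suc N)"
  have K: "K \<ge> 0" using Bf LM X C unfolding K_def by (intro add_nonneg_nonneg mult_nonneg_nonneg) auto
  have "norm (conv_dist (dilate \<phi> t) (dist_of_fun f) x) \<le> K * (1 + \<bar>x\<bar>) powr (- real (Suc N))" if t: "t > 0" for t x
  proof -
    have "norm (conv_dist (dilate \<phi> t) (dist_of_fun f) x) \<le> K / (1 + \<bar>x\<bar>) ^ Suc N"
    proof (cases "\<bar>x\<bar> > X")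
      case True
      have "2 / \<bar>x\<bar> \<le> 4 / (1 + \<bar>x\<bar>)" using True X by (simp add: field_simps)
      then have "(2 / \<bar>x\<bar>) ^ Suc N \<le> (4 / (1 + \<bar>x\<bar>)) ^ Suc N" by (intro power_mono) auto
      then have "M * (C * (2 / \<bar>x\<bar>) ^ Suc N) \<le> M * (C * (4 / (1 + \<bar>x\<bar>)) ^ Suc N)"
        using LM C by (intro mult_left_mono) auto
      also have "\<dots> = M * (C * 4 ^ Suc N) / (1 + \<bar>x\<bar>) ^ Suc N" by (simp only: power_divide times_divide_eq_right)
      also have "\<dots> \<le> K / (1 + \<bar>x\<bar>) ^ Suc N"
        using Bf LM X unfolding K_def by (intro divide_right_mono) auto
      finally show ?thesis using far[OF t True] by linarith
    next
      case False
      have "(1 + \<bar>x\<bar>) ^ Suc N \<le> (1 + X) ^ Suc N" using False by (intro power_mono) auto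
      then have "Bf * L * (1 + \<bar>x\<bar>) ^ Suc N \<le> Bf * L * (1 + X) ^ Suc N"
        using Bf LM by (intro mult_left_mono) auto
      also have "\<dots> \<le> K" unfolding K_def using LM C by (simp del: power_Suc)
      finally have "Bf * L \<le> K / (1 + \<bar>x\<bar>) ^ Suc N" by (subst pos_le_divide_eq) auto
      then show ?thesis using near[OF t, of x] by linarith
    qed
    also have "\<dots> = K * (1 + \<bar>x\<bar>) powr (- real (Suc N))"
      by (simp only: powr_minus) (subst powr_realpow, auto simp: divide_inverse)
    finally show ?thesis .
  qed
  then show ?thesis using that K unfolding f_def by blast
qed

text \<open>The maximal function is \<open>O((1 + \<bar>x\<bar>) powr - (N + 1))\<close>, whose \<open>p\<close>-th power is integrable once
  \<open>p * (N + 1) > 1\<close>.\<close>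

lemma fun_in_hardy_fdiff:
  assumes \<phi>: "\<phi> \<in> schwartz" "integral\<^sup>L lebesgue \<phi> = 1" and g: "bdd_cpt_borel g"
    and p: "0 < p" "p * real (Suc N) > 1"
  shows "fun_in_hardy p ((fdiff ^^ N) g)"
proof -
  define f where "f = (fdiff ^^ N) g"
  have f: "bdd_cpt_borel f" unfolding f_def by (rule bdd_cpt_borel_funpow_fdiff[OF g])
  note [measurable] = bdd_cpt_borel_measurable[OF f]
  have "integrable lebesgue (\<lambda>x. f x * \<psi> x)" if "\<psi> \<in> schwartz" for \<psi>
  proof -
    have [measurable]: "\<psi> \<in> borel_measurable borel" using that by (rule schwartz_borel)
    show ?thesis
      using integrable_bdd_cpt_mult[OF f schwartz_continuous[OF that]] by (simp add: integrable_completion)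
  qed
  moreover have "hardy_qnorm \<phi> p (dist_of_fun f) < \<infinity>"
  proof -
    obtain K where K: "K \<ge> 0" "\<And>t x. t > 0 \<Longrightarrow>
      norm (conv_dist (dilate \<phi> t) (dist_of_fun f) x) \<le> K * (1 + \<bar>x\<bar>) powr (- real (Suc N))"
      unfolding f_def using conv_dist_fdiff_decay[OF \<phi> g] by blast
    have "epowr (maximal_fn \<phi> (dist_of_fun f) x) p \<le> ennreal (K powr p * (1 + \<bar>x\<bar>) powr (- (p * real (Suc N))))" for x
    proof -
      have "maximal_fn \<phi> (dist_of_fun f) x \<le> ennreal (K * (1 + \<bar>x\<bar>) powr (- real (Suc N)))"
        unfolding maximal_fn_def by (intro SUP_least ennreal_leI K) auto
      then have "epowr (maximal_fn \<phi> (dist_of_fun f) x) p \<le> ennreal ((K * (1 + \<bar>x\<bar>) powr (- real (Suc N))) powr p)"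
        using p K by (intro epowr_mono_real) auto
      also have "(K * (1 + \<bar>x\<bar>) powr (- real (Suc N))) powr p = K powr p * (1 + \<bar>x\<bar>) powr (- (p * real (Suc N)))"
        using K by (simp add: powr_mult powr_powr mult.commute del: of_nat_Suc)
      finally show ?thesis .
    qed
    then have "(\<integral>\<^sup>+x. epowr (maximal_fn \<phi> (dist_of_fun f) x) p \<partial>lebesgue)
        \<le> (\<integral>\<^sup>+x. ennreal (K powr p * (1 + \<bar>x\<bar>) powr (- (p * real (Suc N)))) \<partial>lebesgue)"
      by (intro nn_integral_mono)
    also have "\<dots> = (\<integral>\<^sup>+x. ennreal (K powr p * (1 + \<bar>x\<bar>) powr (- (p * real (Suc N)))) \<partial>lborel)"
      by (rule nn_integral_completion)
    also have "\<dots> < \<infinity>"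
      using integrable_mult_right[OF integrable_powr_decay[OF p(2)], of "K powr p"] 
      by (simp add: nn_integral_eq_integral del: of_nat_Suc)
    finally show ?thesis by (simp add: hardy_qnorm_def Lp_qnorm_def epowr_def)
  qed
  ultimately show ?thesis
    unfolding fun_in_hardy_def hardy_def f_def[symmetric] using dist_of_fun_tempered[OF f] \<phi> by blast
qed

lemma bdd_cpt_borel_bdd_cpt_supp:
  assumes "bdd_cpt_borel f"
  shows "f \<in> bdd_cpt_supp"
proof -
  obtain B R where BR: "B > 0" "R > 0" "\<And>x. norm (f x) \<le> B" "\<And>x. R < \<bar>x\<bar> \<Longrightarrow> f x = 0"
    using assms by (rule bdd_cpt_borelE) blast
  have "{x. f x \<noteq> 0} \<subseteq> {-R..R}" using BR(4) by (force simp: abs_le_iff not_less)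
  then have "bounded {x. f x \<noteq> 0}" using bounded_closed_interval bounded_subset by blast
  then have "compact (closure {x. f x \<noteq> 0})" by (simp add: compact_closure)
  moreover have "bounded (range f)" using BR(3) by (auto simp: bounded_iff)
  moreover have "f \<in> borel_measurable lebesgue"
    using bdd_cpt_borel_measurable[OF assms] by (simp add: measurable_completion)
  ultimately show ?thesis by (simp add: bdd_cpt_supp_def)
qed

section \<open>The kernel and its truncated integral\<close>

lemma powr_add_minus_powr_le:
  fixes y v b :: real
  assumes "0 < y" "\<bar>v\<bar> \<le> y / 2" "b \<le> 1"
  shows "\<bar>(y + v) powr b - y powr b\<bar> \<le> \<bar>b\<bar> * \<bar>v\<bar> * (y / 2) powr (b - 1)"
proof -
  have D: "((\<lambda>u. u powr b) has_real_derivative b * u powr (b - 1)) (at u within {y/2..})"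
    if "u \<in> {y/2..}" for u
    using that assms by (auto intro!: derivative_eq_intros)
  have "norm ((y + v) powr b - y powr b) \<le> (\<bar>b\<bar> * (y / 2) powr (b - 1)) * norm (y + v - y)"
  proof (rule field_differentiable_bound[OF _ D])
    show "norm (b * u powr (b - 1)) \<le> \<bar>b\<bar> * (y / 2) powr (b - 1)" if "u \<in> {y/2..}" for u
      using that assms unfolding real_norm_def abs_mult
      by (intro mult_left_mono) (auto intro!: powr_mono2')
  qed (use assms in auto)
  then show ?thesis by (simp add: mult_ac)
qed

text \<open>The kernel is constant between \<open>t\<close> and \<open>s\<close> and a power of \<open>\<bar>2 * x - (s + t)\<bar>\<close> outside. Its integral
  over the line diverges, but the divergent part depends on \<open>A\<close> and only weakly on \<open>s\<close> and \<open>t\<close>;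
  what remains is a nonzero multiple of a power of \<open>s - t\<close>.\<close>

lemma integral_truncated_kernel:
  fixes s t A a :: real
  assumes a: "0 < a" "a < 1" and st: "t < s" "- A \<le> t" "s \<le> A"
  shows "(LINT x|lborel. indicator {-A..A} x * (\<bar>x - s\<bar> + \<bar>x - t\<bar>) powr (a - 1))
    = (1 - 1 / a) * (s - t) powr a + ((2 * A - (s + t)) powr a + (2 * A + (s + t)) powr a) / (2 * a)"
proof -
  let ?k = "\<lambda>x. (\<bar>x - s\<bar> + \<bar>x - t\<bar>) powr (a - 1)"
  have 1: "(?k has_integral (0 - (s - t) powr a / (2 * a)) - (0 - (2 * A + (s + t)) powr a / (2 * a))) {-A..t}"
  proof (rule has_integral_eq)
    have "((\<lambda>x. (s + t - 2 * x) powr (a - 1)) has_integral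
        - ((s + t - 2 * t) powr a / (2 * a)) - (- ((s + t - 2 * (-A)) powr a / (2 * a)))) {-A..t}"
    proof (rule fundamental_theorem_of_calculus)
      show "((\<lambda>x. - ((s + t - 2 * x) powr a / (2 * a))) has_vector_derivative (s + t - 2 * x) powr (a - 1)) (at x within {-A..t})"
        if "x \<in> {-A..t}" for x
        unfolding has_real_derivative_iff_has_vector_derivative[symmetric]
        using that st a by (auto intro!: derivative_eq_intros)
    qed (use st in auto)
    then show "((\<lambda>x. (s + t - 2 * x) powr (a - 1)) has_integral
       (0 - (s - t) powr a / (2 * a)) - (0 - (2 * A + (s + t)) powr a / (2 * a))) {-A..t}"
      by (simp add: algebra_simps)
  qed (use st in \<open>auto simp: algebra_simps\<close>)
  have 2: "(?k has_integral (s - t) powr a) {t..s}"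
  proof (rule has_integral_eq)
    have "((\<lambda>x. (s - t) powr (a - 1)) has_integral measure lborel {t..s} *\<^sub>R (s - t) powr (a - 1)) {t..s}"
      by (rule has_integral_const_real)
    moreover have "(s - t) * (s - t) powr (a - 1) = (s - t) powr a"
      using st by (simp add: powr_mult_base)
    ultimately show "((\<lambda>x. (s - t) powr (a - 1)) has_integral (s - t) powr a) {t..s}"
      using st by simp
  qed auto
  have 3: "(?k has_integral (2 * A - (s + t)) powr a / (2 * a) - (s - t) powr a / (2 * a)) {s..A}"
  proof (rule has_integral_eq)
    have "((\<lambda>x. (2 * x - (s + t)) powr (a - 1)) has_integral
        (2 * A - (s + t)) powr a / (2 * a) - (2 * s - (s + t)) powr a / (2 * a)) {s..A}"
    proof (rule fundamental_theorem_of_calculus)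
      show "((\<lambda>x. (2 * x - (s + t)) powr a / (2 * a)) has_vector_derivative (2 * x - (s + t)) powr (a - 1)) (at x within {s..A})"
        if "x \<in> {s..A}" for x
        unfolding has_real_derivative_iff_has_vector_derivative[symmetric]
        using that st a by (auto intro!: derivative_eq_intros)
    qed (use st in auto)
    then show "((\<lambda>x. (2 * x - (s + t)) powr (a - 1)) has_integral
        (2 * A - (s + t)) powr a / (2 * a) - (s - t) powr a / (2 * a)) {s..A}"
      by (simp add: algebra_simps)
  qed (use st in \<open>auto simp: algebra_simps\<close>)
  have "(?k has_integral
      ((0 - (s - t) powr a / (2 * a)) - (0 - (2 * A + (s + t)) powr a / (2 * a)) + (s - t) powr a)
        + ((2 * A - (s + t)) powr a / (2 * a) - (s - t) powr a / (2 * a))) {-A..A}"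
    by (rule has_integral_combine[OF _ _ has_integral_combine[OF _ _ 1 2] 3]) (use st in auto)
  moreover have "set_integrable lborel {-A..A} ?k"
  proof (rule borel_integrable_atLeastAtMost')
    have "\<bar>x - s\<bar> + \<bar>x - t\<bar> \<noteq> 0" for x using st by linarith
    then show "continuous_on {-A..A} ?k" by (intro continuous_intros) auto
  qed
  ultimately show ?thesis
    using set_borel_integral_eq_integral(2)[of "{-A..A}" ?k]
    by (simp add: set_lebesgue_integral_def integral_unique add_divide_distrib algebra_simps)
qed

lemma borel_measurable_fst_mult_snd:
  assumes [measurable]: "u \<in> borel_measurable borel" "v \<in> borel_measurable borel"
  shows "(\<lambda>z::real\<times>real. u (fst z) * v (snd z) :: complex) \<in> borel_measurable borel"
  unfolding borel_prod[symmetric] by measurable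

section \<open>The energy integral of two differences\<close>

text \<open>Both orders of iterated integration are needed: differences are moved in one variable at a time.\<close>

lemma double_integral:
  fixes G :: "real \<times> real \<Rightarrow> complex"
  assumes u: "bdd_cpt_borel u" and v: "bdd_cpt_borel v" and G: "continuous_on UNIV G"
  shows "integrable lborel (\<lambda>z. u (fst z) * v (snd z) * G z)"
    and "(LINT z|lborel. u (fst z) * v (snd z) * G z) = (LINT s|lborel. u s * (LINT t|lborel. v t * G (s, t)))"
    and "(LINT z|lborel. u (fst z) * v (snd z) * G z) = (LINT t|lborel. v t * (LINT s|lborel. u s * G (s, t)))"
proof -
  note [measurable] = bdd_cpt_borel_measurable[OF u] bdd_cpt_borel_measurable[OF v]
  have [measurable]: "G \<in> borel_measurable borel" by (rule borel_measurable_continuous_onI[OF G])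
  obtain B1 R1 where 1: "B1 > 0" "R1 > 0" "\<And>x. norm (u x) \<le> B1" "\<And>x. R1 < \<bar>x\<bar> \<Longrightarrow> u x = 0"
    using u by (rule bdd_cpt_borelE) blast
  obtain B2 R2 where 2: "B2 > 0" "R2 > 0" "\<And>x. norm (v x) \<le> B2" "\<And>x. R2 < \<bar>x\<bar> \<Longrightarrow> v x = 0"
    using v by (rule bdd_cpt_borelE) blast
  define S where "S = {-R1..R1} \<times> {-R2..R2}"
  have "compact S" unfolding S_def by (intro compact_Times) auto
  then have "compact (G ` S)" by (intro compact_continuous_image continuous_on_subset[OF G]) auto
  then obtain D where D: "D > 0" "\<And>z. z \<in> S \<Longrightarrow> norm (G z) \<le> D"
    using bounded_pos compact_imp_bounded by (metis imageI)
  have 0: "u (fst z) * v (snd z) * G z = 0" if "z \<notin> S" for z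
  proof -
    have "R1 < \<bar>fst z\<bar> \<or> R2 < \<bar>snd z\<bar>"
      using that unfolding S_def by (cases z) (simp, linarith)
    then show ?thesis using 1(4) 2(4) by auto
  qed
  show int: "integrable lborel (\<lambda>z. u (fst z) * v (snd z) * G z)"
  proof (rule integrable_bounded_support[where S = S and B = "B1 * B2 * D"])
    show "(\<lambda>z. u (fst z) * v (snd z) * G z) \<in> borel_measurable borel"
      by (intro borel_measurable_times borel_measurable_fst_mult_snd) measurable
    show "bounded S" using \<open>compact S\<close> by (rule compact_imp_bounded)
    show "norm (u (fst z) * v (snd z) * G z) \<le> B1 * B2 * D" for z
    proof (cases "z \<in> S")
      case True
      then show ?thesis using 1 2 D unfolding norm_mult by (intro mult_mono) auto
    next
      case False
      then show ?thesis unfolding 0[OF False] using 1(1) 2(1) D(1) by simp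
    qed
  qed (use 0 in auto)
  then have int': "integrable (lborel \<Otimes>\<^sub>M lborel) (case_prod (\<lambda>s t. u s * v t * G (s, t)))"
    unfolding lborel_prod by (simp add: case_prod_beta')
  have eq: "(LINT z|lborel. u (fst z) * v (snd z) * G z)
      = integral\<^sup>L (lborel \<Otimes>\<^sub>M lborel) (case_prod (\<lambda>s t. u s * v t * G (s, t)))"
    unfolding lborel_prod by (simp add: case_prod_beta')
  show "(LINT z|lborel. u (fst z) * v (snd z) * G z) = (LINT s|lborel. u s * (LINT t|lborel. v t * G (s, t)))"
    unfolding eq lborel_pair.integral_fst[OF int', symmetric] by (simp add: mult.assoc)
  show "(LINT z|lborel. u (fst z) * v (snd z) * G z) = (LINT t|lborel. v t * (LINT s|lborel. u s * G (s, t)))"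
    unfolding eq lborel_pair.integral_snd[OF int', symmetric]
    by (simp add: mult.assoc mult.left_commute[of "u _"])
qed

text \<open>Moving the differences from \<open>f1\<close> and \<open>f2\<close> to the power leaves its difference of order \<open>N + 1\<close>,
  integrated over a product of two unit intervals. These are placed so far apart that the argument of
  this difference stays in \<open>{2..4}\<close>, away from the singularity at \<open>0\<close>; there it has a strict constant
  sign, so nothing can cancel.\<close>

lemma fdiff_energy_nonzero:
  fixes a :: real and N :: nat
  assumes a: "0 < a" "a < 1"
  defines "f1 \<equiv> fdiff (indicator {0..1})" and "f2 \<equiv> (fdiff ^^ N) (indicator {-4..-3})"
  shows "(LINT z|lborel. f1 (fst z) * f2 (snd z) * complex_of_real (\<bar>fst z - snd z\<bar> powr a)) \<noteq> 0"
proof -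
  define g1 g2 :: "real \<Rightarrow> complex" where "g1 = indicator {0..1}" and "g2 = indicator {-4..-3}"
  have g: "bdd_cpt_borel g1" "bdd_cpt_borel g2" unfolding g1_def g2_def by (rule bdd_cpt_borel_indicator)+
  have f1: "f1 = fdiff g1" and f2: "f2 = (fdiff ^^ N) g2" by (auto simp: f1_def f2_def g1_def g2_def)
  have f: "bdd_cpt_borel f1" "bdd_cpt_borel f2"
    unfolding f1 f2 by (intro bdd_cpt_borel_fdiff bdd_cpt_borel_funpow_fdiff g)+
  define w where "w u = \<bar>u\<bar> powr a" for u :: real
  define W where "W u = complex_of_real (w u)" for u
  define D where "D = (fdiff ^^ Suc N) w"
  have cw: "continuous_on UNIV w"
    unfolding w_def[abs_def] using a by (intro continuous_on_powr' continuous_intros) auto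
  then have cW: "continuous_on UNIV W" unfolding W_def[abs_def] by (intro continuous_intros)
  define V where "V = (fdiff ^^ N) W"
  have cV: "continuous_on UNIV V" unfolding V_def by (rule continuous_on_funpow_fdiff[OF cW])
  have cD: "continuous_on UNIV D" unfolding D_def by (rule continuous_on_funpow_fdiff[OF cw])
  have V_diff: "V (r - 1) - V r = - complex_of_real (D (r - 1))" for r
    unfolding V_def D_def funpow_fdiff_Suc W_def[abs_def] funpow_fdiff_of_real by simp
  have cW2: "continuous_on UNIV (\<lambda>z. W (fst z - snd z))"
    and cV2: "continuous_on UNIV (\<lambda>z. V (fst z - snd z))"
    and cD2: "continuous_on UNIV (\<lambda>z. - complex_of_real (D (fst z - snd z - 1)))"
    by (intro continuous_intros continuous_on_compose2[OF cW] continuous_on_compose2[OF cV]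
        continuous_on_compose2[OF cD]; simp)+
  have cV': "continuous_on UNIV (\<lambda>u. V (- u))"
    by (intro continuous_intros continuous_on_compose2[OF cV]) auto
  have "(LINT z|lborel. f1 (fst z) * f2 (snd z) * W (fst z - snd z))
      = (LINT s|lborel. f1 s * (LINT t|lborel. f2 t * W (s - t)))"
    using double_integral(2)[OF f cW2] by simp
  also have "\<dots> = (LINT s|lborel. f1 s * (LINT t|lborel. g2 t * V (s - t)))"
    unfolding f2 V_def integral_funpow_fdiff_mult[OF g(2) cW] ..
  also have "\<dots> = (LINT t|lborel. g2 t * (LINT s|lborel. f1 s * V (s - t)))"
    using double_integral(2,3)[OF f(1) g(2) cV2] by simp
  also have "\<dots> = (LINT t|lborel. g2 t * (LINT s|lborel. g1 s * - complex_of_real (D (s - t - 1))))"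
  proof -
    have "(LINT s|lborel. f1 s * V (s - t)) = (LINT s|lborel. g1 s * - complex_of_real (D (s - t - 1)))" for t
    proof -
      have "(LINT s|lborel. f1 s * V (s - t)) = (LINT s|lborel. g1 s * fdiff (\<lambda>u. V (- u)) (t - s))"
        using integral_funpow_fdiff_mult[OF g(1) cV', of 1 t] by (simp add: f1)
      moreover have "fdiff (\<lambda>u. V (- u)) (t - s) = - complex_of_real (D (s - t - 1))" for s
        using V_diff[of "s - t"] by (simp add: fdiff_def diff_diff_eq algebra_simps)
      ultimately show ?thesis by simp
    qed
    then show ?thesis by simp
  qed
  also have "\<dots> = (LINT z|lborel. g1 (fst z) * g2 (snd z) * - complex_of_real (D (fst z - snd z - 1)))"
    using double_integral(3)[OF g cD2] by simp
  also have "\<dots> = complex_of_real (LINT z|lborel. - (indicator ({0..1} \<times> {-4..-3}) z * D (fst z - snd z - 1)))"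
    unfolding integral_complex_of_real[symmetric]
    by (intro Bochner_Integration.integral_cong) (auto simp: g1_def g2_def indicator_def)
  finally have eq: "(LINT z|lborel. f1 (fst z) * f2 (snd z) * W (fst z - snd z))
    = - complex_of_real (LINT z|lborel. indicator ({0..1} \<times> {-4..-3}) z * D (fst z - snd z - 1))" by simp
  have "compact ({2..4}::real set)" "{2..4} \<noteq> ({}::real set)" "continuous_on {2..4} (\<lambda>u. (-1) ^ N * D u)"
    by (auto intro!: continuous_intros continuous_on_subset[OF cD])
  from continuous_attains_inf[OF this] obtain c where c: "c \<in> {2..4}"
    "\<And>u. u \<in> {2..4} \<Longrightarrow> (-1) ^ N * D c \<le> (-1) ^ N * D u" by blast
  define m where "m = (-1) ^ N * D c"
  have m: "m > 0" using funpow_fdiff_powr_sign[OF a, of c N] c unfolding m_def D_def w_def[abs_def] by simp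
  let ?S = "{0..1} \<times> {-4..-3} :: (real \<times> real) set"
  have S: "?S = cbox (0, -4) (1, -3)" by (simp add: cbox_Pair_eq)
  have "m = (LINT z|lborel. indicator ?S z * m)"
    unfolding S by (simp add: content_Pair)
  also have "\<dots> \<le> (LINT z|lborel. (-1) ^ N * (indicator ?S z * D (fst z - snd z - 1)))"
  proof (rule integral_mono)
    have "integrable lborel (\<lambda>z. indicator ?S z *\<^sub>R ((-1) ^ N * D (fst z - snd z - 1)))"
      unfolding S by (intro borel_integrable_compact compact_cbox continuous_intros
        continuous_on_compose2[OF cD]) auto
    then show "integrable lborel (\<lambda>z. (-1) ^ N * (indicator ?S z * D (fst z - snd z - 1)))"
      by (simp add: mult.left_commute)
    show "integrable lborel (\<lambda>z. indicator ?S z * m)"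
      unfolding S by (intro integrable_mult_left integrable_real_indicator)
        (use emeasure_lborel_cbox_finite in \<open>auto simp: less_top\<close>)
    show "indicator ?S z * m \<le> (-1) ^ N * (indicator ?S z * D (fst z - snd z - 1))" for z
      using c(2)[of "fst z - snd z - 1"] by (cases z) (auto simp: indicator_def m_def)
  qed
  also have "\<dots> = (-1) ^ N * (LINT z|lborel. indicator ?S z * D (fst z - snd z - 1))" by simp
  finally have "(LINT z|lborel. indicator ?S z * D (fst z - snd z - 1)) \<noteq> 0" using m by auto
  then show ?thesis using eq unfolding W_def w_def by simp
qed

section \<open>The integral of the fractional integral\<close>

lemma integral_fdiff_eq_0:
  assumes "bdd_cpt_borel g"
  shows "(LINT x|lborel. fdiff g x) = 0"
proof -
  have "(fdiff ^^ 1) (\<lambda>_. 1 :: complex) x = 0" for x :: real by (simp add: fdiff_def)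
  then show ?thesis
    using integral_funpow_fdiff_mult[OF assms, of "\<lambda>_. 1" 1 0] by simp
qed

definition tensor :: "(real \<Rightarrow> complex) \<Rightarrow> (real \<Rightarrow> complex) \<Rightarrow> real \<times> real \<Rightarrow> complex" where
  "tensor f1 f2 z = f1 (fst z) * f2 (snd z)"

definition frac_kernel :: "real \<Rightarrow> real \<Rightarrow> real \<times> real \<Rightarrow> real" where
  "frac_kernel \<gamma> x z = (\<bar>x - fst z\<bar> + \<bar>x - snd z\<bar>) powr (\<gamma> - 2)"

text \<open>The supports of \<open>f1\<close> and \<open>f2\<close> are kept at distance at least \<open>1\<close>, so that the kernel is bounded by
  \<open>1\<close> on the support of the product, and Fubini's theorem is applied to bounded functions only. The one
  cancellation of \<open>f1\<close> is what makes the fractional integral integrable at infinity.\<close>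

context
  fixes f1 f2 :: "real \<Rightarrow> complex" and \<gamma> R :: real
  assumes \<gamma>: "1 < \<gamma>" "\<gamma> < 2"
    and f1: "bdd_cpt_borel f1" and f2: "bdd_cpt_borel f2"
    and R: "R > 0"
    and supp: "\<And>s t. f1 s * f2 t \<noteq> 0 \<Longrightarrow> t + 1 \<le> s \<and> \<bar>s\<bar> \<le> R \<and> \<bar>t\<bar> \<le> R"
    and mean_zero: "(LINT s|lborel. f1 s) = 0"
begin

abbreviation F :: "real \<times> real \<Rightarrow> complex" where "F \<equiv> tensor f1 f2"

abbreviation K :: "real \<Rightarrow> real \<times> real \<Rightarrow> real" where "K \<equiv> frac_kernel \<gamma>"

lemma tensor_borel [measurable]: "F \<in> borel_measurable borel"
  unfolding tensor_def[abs_def] by (intro borel_measurable_fst_mult_snd bdd_cpt_borel_measurable f1 f2)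

lemma kernel_borel [measurable]: "(\<lambda>y. K (fst y) (snd y)) \<in> borel_measurable (borel \<Otimes>\<^sub>M borel)"
  unfolding frac_kernel_def[abs_def] borel_prod[symmetric] by measurable

lemma kernel_borel_fixed [measurable]: "K x \<in> borel_measurable borel"
  unfolding frac_kernel_def[abs_def] borel_prod[symmetric] by measurable

lemma tensor_integrable: "integrable lborel F" and tensor_integral_zero: "integral\<^sup>L lborel F = 0"
proof -
  have c: "continuous_on UNIV (\<lambda>_::real\<times>real. 1::complex)" by simp
  show "integrable lborel F" using double_integral(1)[OF f1 f2 c] by (simp add: tensor_def[abs_def])
  show "integral\<^sup>L lborel F = 0" using double_integral(3)[OF f1 f2 c] mean_zero by (simp add: tensor_def[abs_def])
qed

lemma tensor_support: "F z \<noteq> 0 \<Longrightarrow> snd z + 1 \<le> fst z \<and> \<bar>fst z\<bar> \<le> R \<and> \<bar>snd z\<bar> \<le> R"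
  using supp unfolding tensor_def by blast

lemma tensor_bounded: obtains B where "B > 0" "\<And>z. norm (F z) \<le> B"
proof -
  obtain B1 where 1: "B1 > 0" "\<And>x. norm (f1 x) \<le> B1" using f1 by (rule bdd_cpt_borelE) blast
  obtain B2 where 2: "B2 > 0" "\<And>x. norm (f2 x) \<le> B2" using f2 by (rule bdd_cpt_borelE) blast
  have "norm (F z) \<le> B1 * B2" for z
    unfolding tensor_def norm_mult using 1 2 by (intro mult_mono) auto
  then show ?thesis using that[of "B1 * B2"] 1 2 by simp
qed

lemma norm_tensor_kernel_le: "norm (F z * complex_of_real (K x z)) \<le> norm (F z)"
proof (cases "F z = 0")
  case False
  have "K x z \<le> (\<bar>x - fst z\<bar> + \<bar>x - snd z\<bar>) powr 0"
    unfolding frac_kernel_def using tensor_support[OF False] \<gamma> by (intro powr_mono) linarith+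
  then have "K x z \<le> 1" by (simp add: powr_def split: if_splits)
  moreover have "K x z \<ge> 0" by (simp add: frac_kernel_def)
  ultimately show ?thesis using mult_left_mono[of "K x z" 1 "norm (F z)"] by (simp add: norm_mult)
qed simp

lemma tensor_kernel_integrable: "integrable lborel (\<lambda>z. F z * complex_of_real (K x z))"
  by (rule Bochner_Integration.integrable_bound[OF tensor_integrable]) (auto intro!: AE_I2 norm_tensor_kernel_le)

lemma frac_int_eq: "frac_int \<gamma> f1 f2 x = (LINT z|lborel. F z * complex_of_real (K x z))"
proof -
  have "f1 s * f2 t / complex_of_real ((\<bar>x - s\<bar> + \<bar>x - t\<bar>) powr (2 - \<gamma>))
      = F (s, t) * complex_of_real (K x (s, t))" for s t
    using powr_minus[of "\<bar>x - s\<bar> + \<bar>x - t\<bar>" "2 - \<gamma>"]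
    by (simp add: tensor_def frac_kernel_def divide_inverse)
  then have "frac_int \<gamma> f1 f2 x = (LINT z|lebesgue. F z * complex_of_real (K x z))"
    unfolding frac_int_def by (simp add: case_prod_beta')
  also have "\<dots> = (LINT z|lborel. F z * complex_of_real (K x z))"
    by (rule lebesgue_integral_lborel) measurable
  finally show ?thesis .
qed

lemma frac_int_borel [measurable]: "frac_int \<gamma> f1 f2 \<in> borel_measurable borel"
proof -
  have "(\<lambda>x. LINT z|lborel. F z * complex_of_real (K x z)) \<in> borel_measurable lborel"
  proof (rule lborel.borel_measurable_lebesgue_integral)
    have "(\<lambda>(x, z). F z * complex_of_real (K x z)) \<in> borel_measurable (borel \<Otimes>\<^sub>M borel)"
      unfolding case_prod_beta' by measurable
    then show "(\<lambda>(x, z). F z * complex_of_real (K x z)) \<in> borel_measurable (lborel \<Otimes>\<^sub>M lborel)"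
      by (simp cong: measurable_cong_sets)
  qed
  then show ?thesis unfolding frac_int_eq[abs_def] by simp
qed

text \<open>Since \<open>f1 (s) * f2 (t)\<close> has integral zero, a function \<open>h\<close> may be replaced by \<open>h - c\<close>: only its
  oscillation on the support counts. This gives both the decay of the fractional integral and the
  disappearance of the divergent part of the truncated kernel integral.\<close>

lemma norm_integral_tensor_le:
  assumes h: "h \<in> borel_measurable borel" and le: "\<And>z. F z \<noteq> 0 \<Longrightarrow> \<bar>h z - c\<bar> \<le> e"
  shows "norm (LINT z|lborel. F z * complex_of_real (h z)) \<le> (LINT z|lborel. norm (F z)) * e"
proof -
  note [measurable] = h
  have b: "norm (F z * complex_of_real (h z - c)) \<le> norm (F z) * e" for z
  proof (cases "F z = 0")
    case False
    then show ?thesis unfolding norm_mult norm_of_real by (intro mult_left_mono le) auto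
  qed simp
  have i: "integrable lborel (\<lambda>z. norm (F z) * e)"
    by (intro integrable_mult_left integrable_norm tensor_integrable)
  have i': "integrable lborel (\<lambda>z. F z * complex_of_real (h z - c))"
  proof (rule Bochner_Integration.integrable_bound[OF i])
    show "AE z in lborel. norm (F z * complex_of_real (h z - c)) \<le> norm (norm (F z) * e)"
      by (rule AE_I2, rule order_trans[OF b]) simp
  qed measurable
  have ic: "integrable lborel (\<lambda>z. F z * complex_of_real c)"
    by (intro integrable_mult_left tensor_integrable)
  have "(LINT z|lborel. F z * complex_of_real (h z))
      = (LINT z|lborel. F z * complex_of_real (h z - c) + F z * complex_of_real c)"
    by (simp add: algebra_simps)
  also have "\<dots> = (LINT z|lborel. F z * complex_of_real (h z - c))"
    unfolding Bochner_Integration.integral_add[OF i' ic] by (simp add: tensor_integral_zero)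
  also have "norm \<dots> \<le> (LINT z|lborel. norm (F z * complex_of_real (h z - c)))"
    by (rule integral_norm_bound)
  also have "\<dots> \<le> (LINT z|lborel. norm (F z) * e)"
    using i' i by (intro integral_mono integrable_norm b)
  finally show ?thesis by simp
qed

text \<open>For \<open>\<bar>x\<bar> > 2 * R\<close> the kernel differs from \<open>(2 * \<bar>x\<bar>) powr (\<gamma> - 2)\<close>, which is constant in \<open>s\<close> and \<open>t\<close>,
  by \<open>O(\<bar>x\<bar> powr (\<gamma> - 3))\<close>; this is integrable at infinity because \<open>\<gamma> < 2\<close>.\<close>

lemma frac_int_integrable: "integrable lborel (frac_int \<gamma> f1 f2)"
proof -
  define M where "M = (LINT z|lborel. norm (F z))"
  have M: "M \<ge> 0" by (simp add: M_def)
  have far: "norm (frac_int \<gamma> f1 f2 x) \<le> M * (2 * R * \<bar>x\<bar> powr (\<gamma> - 3))" if x: "\<bar>x\<bar> > 2 * R" for x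
    unfolding frac_int_eq M_def
  proof (rule norm_integral_tensor_le[where c = "(2 * \<bar>x\<bar>) powr (\<gamma> - 2)"])
    fix z assume "F z \<noteq> 0"
    note z = tensor_support[OF this]
    define v where "v = (if x > 0 then - (fst z + snd z) else fst z + snd z)"
    have eq: "\<bar>x - fst z\<bar> + \<bar>x - snd z\<bar> = 2 * \<bar>x\<bar> + v"
    proof (cases "x > 0")
      case True
      then show ?thesis using z x unfolding v_def by auto
    next
      case False
      then show ?thesis using z x unfolding v_def by auto
    qed
    have v: "\<bar>v\<bar> \<le> 2 * R" using z unfolding v_def by auto
    have "\<bar>(2 * \<bar>x\<bar> + v) powr (\<gamma> - 2) - (2 * \<bar>x\<bar>) powr (\<gamma> - 2)\<bar>
        \<le> \<bar>\<gamma> - 2\<bar> * \<bar>v\<bar> * (2 * \<bar>x\<bar> / 2) powr (\<gamma> - 2 - 1)"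
      by (rule powr_add_minus_powr_le) (use v x R \<gamma> in auto)
    also have "\<dots> \<le> 1 * (2 * R) * (2 * \<bar>x\<bar> / 2) powr (\<gamma> - 2 - 1)"
      using v \<gamma> R by (intro mult_mono) auto
    finally show "\<bar>K x z - (2 * \<bar>x\<bar>) powr (\<gamma> - 2)\<bar> \<le> 2 * R * \<bar>x\<bar> powr (\<gamma> - 3)"
      by (simp add: frac_kernel_def eq)
  qed measurable
  have near: "norm (frac_int \<gamma> f1 f2 x) \<le> M" for x
    unfolding frac_int_eq M_def
    by (rule order_trans[OF integral_norm_bound])
       (intro integral_mono integrable_norm tensor_kernel_integrable tensor_integrable norm_tensor_kernel_le)
  define C where "C = M * (1 + 2 * R) powr (3 - \<gamma>) + M * (2 * R * (1 / (2 * R) + 1) powr (3 - \<gamma>))"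
  have "norm (frac_int \<gamma> f1 f2 x) \<le> C * (1 + \<bar>x\<bar>) powr (- (3 - \<gamma>))" for x
  proof (cases "\<bar>x\<bar> > 2 * R")
    case True
    have "(1 + \<bar>x\<bar>) powr (3 - \<gamma>) \<le> ((1 / (2 * R) + 1) * \<bar>x\<bar>) powr (3 - \<gamma>)"
      using True R \<gamma> by (intro powr_mono2) (auto simp: field_simps)
    also have "\<dots> = (1 / (2 * R) + 1) powr (3 - \<gamma>) * \<bar>x\<bar> powr (3 - \<gamma>)"
      using R by (simp add: powr_mult)
    finally have "(1 + \<bar>x\<bar>) powr (3 - \<gamma>) * \<bar>x\<bar> powr (\<gamma> - 3)
        \<le> (1 / (2 * R) + 1) powr (3 - \<gamma>) * \<bar>x\<bar> powr (3 - \<gamma>) * \<bar>x\<bar> powr (\<gamma> - 3)"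
      by (rule mult_right_mono) simp
    moreover have "\<bar>x\<bar> powr (3 - \<gamma>) * \<bar>x\<bar> powr (\<gamma> - 3) = 1"
      using True R by (simp flip: powr_add)
    ultimately have "\<bar>x\<bar> powr (\<gamma> - 3) * (1 + \<bar>x\<bar>) powr (3 - \<gamma>) \<le> (1 / (2 * R) + 1) powr (3 - \<gamma>)"
      by (simp only: mult.assoc mult_1_right mult.commute[of "(1 + \<bar>x\<bar>) powr (3 - \<gamma>)"])
    then have "\<bar>x\<bar> powr (\<gamma> - 3) \<le> (1 / (2 * R) + 1) powr (3 - \<gamma>) / (1 + \<bar>x\<bar>) powr (3 - \<gamma>)"
      by (subst pos_le_divide_eq) auto
    then have "\<bar>x\<bar> powr (\<gamma> - 3) \<le> (1 / (2 * R) + 1) powr (3 - \<gamma>) * (1 + \<bar>x\<bar>) powr (- (3 - \<gamma>))"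
      by (simp only: powr_minus divide_inverse)
    then have "M * (2 * R * \<bar>x\<bar> powr (\<gamma> - 3))
        \<le> M * (2 * R * ((1 / (2 * R) + 1) powr (3 - \<gamma>) * (1 + \<bar>x\<bar>) powr (- (3 - \<gamma>))))"
      using M R by (intro mult_left_mono) auto
    also have "\<dots> \<le> C * (1 + \<bar>x\<bar>) powr (- (3 - \<gamma>))"
      unfolding C_def distrib_right using M by (simp add: mult.assoc)
    finally show ?thesis using far[OF True] by linarith
  next
    case False
    have "(1 + \<bar>x\<bar>) powr (3 - \<gamma>) \<le> (1 + 2 * R) powr (3 - \<gamma>)"
      using False \<gamma> by (intro powr_mono2) auto
    then have "(1 + \<bar>x\<bar>) powr (3 - \<gamma>) * (1 + \<bar>x\<bar>) powr (- (3 - \<gamma>))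
        \<le> (1 + 2 * R) powr (3 - \<gamma>) * (1 + \<bar>x\<bar>) powr (- (3 - \<gamma>))"
      by (rule mult_right_mono) simp
    moreover have "(1 + \<bar>x\<bar>) powr (3 - \<gamma>) * (1 + \<bar>x\<bar>) powr (- (3 - \<gamma>)) = 1"
      unfolding powr_add[symmetric] by simp
    ultimately have "M * 1 \<le> M * ((1 + 2 * R) powr (3 - \<gamma>) * (1 + \<bar>x\<bar>) powr (- (3 - \<gamma>)))"
      using M by (intro mult_left_mono) linarith+
    also have "\<dots> \<le> C * (1 + \<bar>x\<bar>) powr (- (3 - \<gamma>))"
      unfolding C_def distrib_right using M R by (simp add: mult.assoc)
    finally show ?thesis using near[of x] by linarith
  qed
  then have b: "norm (frac_int \<gamma> f1 f2 x) \<le> norm (C * (1 + \<bar>x\<bar>) powr (- (3 - \<gamma>)))" for x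
    by (rule order_trans) simp
  show ?thesis
  proof (rule Bochner_Integration.integrable_bound)
    show "integrable lborel (\<lambda>x. C * (1 + \<bar>x\<bar>) powr (- (3 - \<gamma>)))"
      using \<gamma> by (intro integrable_mult_right integrable_powr_decay) simp
  qed (use b in \<open>auto intro!: AE_I2\<close>)
qed

lemma frac_int_truncated_integral:
  assumes A: "A \<ge> R"
  shows "(LINT x|lborel. indicator {-A..A} x *\<^sub>R frac_int \<gamma> f1 f2 x)
    = (LINT z|lborel. F z * complex_of_real ((1 - 1 / (\<gamma> - 1)) * \<bar>fst z - snd z\<bar> powr (\<gamma> - 1)
        + ((2 * A - (fst z + snd z)) powr (\<gamma> - 1) + (2 * A + (fst z + snd z)) powr (\<gamma> - 1)) / (2 * (\<gamma> - 1))))"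
proof -
  define H where "H x z = F z * complex_of_real (indicator {-A..A} x * K x z)" for x z
  obtain B where B: "B > 0" "\<And>z. norm (F z) \<le> B" by (rule tensor_bounded) blast
  have int: "integrable (lborel \<Otimes>\<^sub>M lborel) (case_prod H)"
    unfolding lborel_prod
  proof (rule integrable_bounded_support[where B = B and S = "{-A..A} \<times> ({-R..R} \<times> {-R..R})"])
    show "case_prod H \<in> borel_measurable borel"
      unfolding H_def case_prod_beta' by (subst borel_prod[symmetric]) measurable
    show "bounded ({-A..A} \<times> ({-R..R} \<times> {-R..R}))"
      by (intro bounded_Times) auto
    show "norm (case_prod H y) \<le> B" for y
    proof -
      obtain x z where Pair: "y = (x, z)" by (rule prod.exhaust)
      have "norm (H x z) \<le> norm (F z * complex_of_real (K x z))"
        by (simp add: H_def indicator_def norm_mult)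
      then show ?thesis using norm_tensor_kernel_le[of z x] B(2)[of z] Pair by simp
    qed
    show "case_prod H y = 0" if y: "y \<notin> {-A..A} \<times> ({-R..R} \<times> {-R..R})" for y
    proof (rule ccontr)
      assume "case_prod H y \<noteq> 0"
      then have "F (snd y) \<noteq> 0" "fst y \<in> {-A..A}" by (auto simp: H_def case_prod_beta' indicator_def split: if_splits)
      then show False using tensor_support[of "snd y"] y by (cases y) auto
    qed
  qed
  have "(LINT x|lborel. indicator {-A..A} x *\<^sub>R frac_int \<gamma> f1 f2 x) = (LINT x|lborel. LINT z|lborel. H x z)"
  proof (intro Bochner_Integration.integral_cong refl)
    fix x
    have "(LINT z|lborel. H x z) = (LINT z|lborel. complex_of_real (indicator {-A..A} x) * (F z * complex_of_real (K x z)))"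
      unfolding H_def by (simp add: mult_ac)
    then show "indicator {-A..A} x *\<^sub>R frac_int \<gamma> f1 f2 x = (LINT z|lborel. H x z)"
      by (simp add: frac_int_eq scaleR_conv_of_real)
  qed
  also have "\<dots> = (LINT z|lborel. LINT x|lborel. H x z)"
    by (rule lborel_pair.Fubini_integral[OF int, symmetric])
  also have "\<dots> = (LINT z|lborel. F z * complex_of_real ((1 - 1 / (\<gamma> - 1)) * \<bar>fst z - snd z\<bar> powr (\<gamma> - 1)
        + ((2 * A - (fst z + snd z)) powr (\<gamma> - 1) + (2 * A + (fst z + snd z)) powr (\<gamma> - 1)) / (2 * (\<gamma> - 1))))"
  proof (intro Bochner_Integration.integral_cong refl)
    fix z
    show "(LINT x|lborel. H x z) = F z * complex_of_real ((1 - 1 / (\<gamma> - 1)) * \<bar>fst z - snd z\<bar> powr (\<gamma> - 1)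
        + ((2 * A - (fst z + snd z)) powr (\<gamma> - 1) + (2 * A + (fst z + snd z)) powr (\<gamma> - 1)) / (2 * (\<gamma> - 1)))"
    proof (cases "F z = 0")
      case False
      have "(LINT x|lborel. H x z) = F z * complex_of_real (LINT x|lborel. indicator {-A..A} x * K x z)"
        unfolding H_def by (simp only: integral_mult_right_zero integral_complex_of_real)
      also have "(LINT x|lborel. indicator {-A..A} x * K x z)
          = (1 - 1 / (\<gamma> - 1)) * (fst z - snd z) powr (\<gamma> - 1)
            + ((2 * A - (fst z + snd z)) powr (\<gamma> - 1) + (2 * A + (fst z + snd z)) powr (\<gamma> - 1)) / (2 * (\<gamma> - 1))"
        using integral_truncated_kernel[of "\<gamma> - 1" "snd z" "fst z" A] \<gamma> tensor_support[OF False] A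
        unfolding frac_kernel_def by auto
      finally show ?thesis using tensor_support[OF False] by simp
    qed (simp add: H_def)
  qed
  finally show ?thesis .
qed

text \<open>The integral over \<open>{-A..A}\<close> is computed by Fubini's theorem. The part of the truncated kernel
  integral that grows with \<open>A\<close> differs from the constant \<open>(2 * A) powr a / a\<close>, where \<open>a = \<gamma> - 1\<close>, by
  \<open>O(A powr (a - 1))\<close>, hence disappears in the limit.\<close>

lemma frac_int_integral:
  "(LINT x|lborel. frac_int \<gamma> f1 f2 x)
    = complex_of_real (1 - 1 / (\<gamma> - 1)) * (LINT z|lborel. F z * complex_of_real (\<bar>fst z - snd z\<bar> powr (\<gamma> - 1)))"
proof -
  define a where "a = \<gamma> - 1"
  have a: "0 < a" "a < 1" using \<gamma> by (auto simp: a_def)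
  \<comment> \<open>The part of the truncated kernel integral that grows with \<open>A\<close>.\<close>
  define E where "E A z = ((2 * A - (fst z + snd z)) powr a + (2 * A + (fst z + snd z)) powr a) / (2 * a)"
    for A :: real and z :: "real \<times> real"
  define w where "w z = \<bar>fst z - snd z\<bar> powr a" for z :: "real \<times> real"
  have E_borel [measurable]: "E A \<in> borel_measurable borel" for A
    unfolding E_def[abs_def] borel_prod[symmetric] by measurable
  have cw: "continuous_on UNIV (\<lambda>z. complex_of_real (w z))"
    unfolding w_def using a by (intro continuous_intros continuous_on_powr') auto
  have iw: "integrable lborel (\<lambda>z. F z * complex_of_real (w z))"
    using double_integral(1)[OF f1 f2 cw] by (simp add: tensor_def)
  define M where "M = (LINT z|lborel. norm (F z))"
  have E_tail: "\<bar>E A z - (2 * A) powr a / a\<bar> \<le> 2 * R * A powr (a - 1)" if "F z \<noteq> 0" "A \<ge> 2 * R" for A z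
  proof -
    define v where "v = fst z + snd z"
    have v: "\<bar>v\<bar> \<le> 2 * R" using tensor_support[OF that(1)] unfolding v_def by linarith
    have *: "\<bar>(2 * A + u) powr a - (2 * A) powr a\<bar> \<le> a * (2 * R) * A powr (a - 1)" if "\<bar>u\<bar> = \<bar>v\<bar>" for u
    proof -
      have "\<bar>(2 * A + u) powr a - (2 * A) powr a\<bar> \<le> \<bar>a\<bar> * \<bar>u\<bar> * (2 * A / 2) powr (a - 1)"
        by (rule powr_add_minus_powr_le) (use that v \<open>A \<ge> 2 * R\<close> R a in auto)
      also have "\<dots> \<le> a * (2 * R) * A powr (a - 1)"
        using that v a by (intro mult_mono) auto
      finally show ?thesis .
    qed
    have "E A z - (2 * A) powr a / a
        = (((2 * A + - v) powr a - (2 * A) powr a) + ((2 * A + v) powr a - (2 * A) powr a)) / (2 * a)"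
      using a by (simp add: E_def v_def field_simps)
    also have "\<bar>\<dots>\<bar> \<le> (a * (2 * R) * A powr (a - 1) + a * (2 * R) * A powr (a - 1)) / (2 * a)"
    proof -
      have "\<bar>2 * a\<bar> = 2 * a" using a by simp
      then show ?thesis
        unfolding abs_divide using a
        by (simp only:) (intro divide_right_mono order_trans[OF abs_triangle_ineq] add_mono *; simp)
    qed
    also have "\<dots> = 2 * R * A powr (a - 1)" using a by (simp add: field_simps)
    finally show ?thesis .
  qed
  have eq: "(LINT x|lborel. indicator {-A..A} x *\<^sub>R frac_int \<gamma> f1 f2 x)
      = complex_of_real (1 - 1 / a) * (LINT z|lborel. F z * complex_of_real (w z)) + (LINT z|lborel. F z * complex_of_real (E A z))"
    if A: "A \<ge> 2 * R" for A
  proof -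
    have i1: "integrable lborel (\<lambda>z. complex_of_real (1 - 1 / a) * (F z * complex_of_real (w z)))"
      by (intro integrable_mult_right iw)
    have "norm (E A z) \<le> (2 * A) powr a / a + 2 * R * A powr (a - 1)" if "F z \<noteq> 0" for z
    proof -
      have "0 \<le> (2 * A) powr a / a" using a by simp
      with E_tail[OF that A] show ?thesis unfolding real_norm_def by linarith
    qed
    then have "norm (F z * complex_of_real (E A z)) \<le> norm (F z * complex_of_real ((2 * A) powr a / a + 2 * R * A powr (a - 1)))" for z
      using R a by (cases "F z = 0") (auto simp: norm_mult simp del: of_real_add intro!: mult_left_mono)
    then have i2: "integrable lborel (\<lambda>z. F z * complex_of_real (E A z))"
      by (intro Bochner_Integration.integrable_bound[OF integrable_mult_left[OF tensor_integrable]] AE_I2) auto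
    have "(LINT x|lborel. indicator {-A..A} x *\<^sub>R frac_int \<gamma> f1 f2 x)
      = (LINT z|lborel. complex_of_real (1 - 1 / a) * (F z * complex_of_real (w z)) + F z * complex_of_real (E A z))"
      using frac_int_truncated_integral[of A] A R unfolding a_def[symmetric] w_def E_def
      by (simp add: algebra_simps)
    also have "\<dots> = complex_of_real (1 - 1 / a) * (LINT z|lborel. F z * complex_of_real (w z)) + (LINT z|lborel. F z * complex_of_real (E A z))"
      unfolding Bochner_Integration.integral_add[OF i1 i2] integral_mult_right_zero ..
    finally show ?thesis .
  qed
  have "((\<lambda>A. M * (2 * R * A powr (a - 1))) \<longlongrightarrow> M * (2 * R * 0)) at_top"
    using a by (intro tendsto_intros tendsto_neg_powr filterlim_ident) auto
  then have rate: "((\<lambda>A. M * (2 * R * A powr (a - 1))) \<longlongrightarrow> 0) at_top" by simp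
  have "((\<lambda>A. LINT z|lborel. F z * complex_of_real (E A z)) \<longlongrightarrow> 0) at_top"
  proof (rule Lim_null_comparison[OF _ rate])
    show "\<forall>\<^sub>F A in at_top. norm (LINT z|lborel. F z * complex_of_real (E A z)) \<le> M * (2 * R * A powr (a - 1))"
      using eventually_ge_at_top[of "2 * R"]
    proof eventually_elim
      case (elim A)
      show ?case unfolding M_def by (rule norm_integral_tensor_le[OF _ E_tail[OF _ elim]]) auto
    qed
  qed
  then have "((\<lambda>A. complex_of_real (1 - 1 / a) * (LINT z|lborel. F z * complex_of_real (w z)) + (LINT z|lborel. F z * complex_of_real (E A z)))
      \<longlongrightarrow> complex_of_real (1 - 1 / a) * (LINT z|lborel. F z * complex_of_real (w z)) + 0) at_top"
    by (intro tendsto_intros)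
  then have lim1: "((\<lambda>A. LINT x|lborel. indicator {-A..A} x *\<^sub>R frac_int \<gamma> f1 f2 x)
      \<longlongrightarrow> complex_of_real (1 - 1 / a) * (LINT z|lborel. F z * complex_of_real (w z)) + 0) at_top"
    by (rule Lim_transform_eventually)
       (use eventually_ge_at_top[of "2 * R"] in eventually_elim, simp add: eq)
  have "((\<lambda>A. LINT x|lborel. indicator {-A..A} x *\<^sub>R frac_int \<gamma> f1 f2 x) \<longlongrightarrow> (LINT x|lborel. frac_int \<gamma> f1 f2 x)) at_top"
  proof (rule integral_dominated_convergence_at_top[where w = "\<lambda>x. norm (frac_int \<gamma> f1 f2 x)"])
    show "AE x in lborel. ((\<lambda>A. indicator {-A..A} x *\<^sub>R frac_int \<gamma> f1 f2 x) \<longlongrightarrow> frac_int \<gamma> f1 f2 x) at_top"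
    proof (rule AE_I2, rule tendsto_eventually)
      fix x :: real
      show "\<forall>\<^sub>F A in at_top. indicator {-A..A} x *\<^sub>R frac_int \<gamma> f1 f2 x = frac_int \<gamma> f1 f2 x"
        using eventually_ge_at_top[of "\<bar>x\<bar>"] by eventually_elim (auto simp: indicator_def)
    qed
  qed (auto intro!: always_eventually integrable_norm frac_int_integrable simp: indicator_def)
  from tendsto_unique[OF _ this lim1] show ?thesis unfolding w_def a_def by simp
qed

end

section \<open>Unboundedness\<close>

theorem theorem3:
  fixes \<gamma> p q :: real and \<phi> :: "real \<Rightarrow> complex"
  assumes "1 < \<gamma>" and "\<gamma> < 2"
    and "0 < p" and "p \<le> 1 / \<gamma>"
    and "1 / q = 1 + 1 / p - \<gamma>"
    and "\<phi> \<in> schwartz" and "integral\<^sup>L lebesgue \<phi> = 1"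
  shows "\<not> hardy_bounded \<phi> (frac_int \<gamma>) 1 p q"
proof
  assume bdd: "hardy_bounded \<phi> (frac_int \<gamma>) 1 p q"
  have "\<gamma> \<le> 1 / p" using assms by (simp add: field_simps)
  then have "1 / q \<ge> 1" using assms(5) by simp
  then have "1 / q > 0" by linarith
  then have q0: "0 < q" by simp
  with \<open>1 / q \<ge> 1\<close> have q: "0 < q" "q \<le> 1" by (auto simp: field_simps)
  obtain N :: nat where "1 / p < real N" using reals_Archimedean2 by blast
  \<comment> \<open>Enough differences for membership in the Hardy space of exponent \<open>p\<close>.\<close>
  then have N: "p * real (Suc N) > 1" using assms(3) by (simp add: field_simps)
  define g1 g2 :: "real \<Rightarrow> complex" where "g1 = indicator {0..1}" and "g2 = indicator {-4..-3}"
  have g: "bdd_cpt_borel g1" "bdd_cpt_borel g2" unfolding g1_def g2_def by (rule bdd_cpt_borel_indicator)+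
  define f1 f2 where "f1 = fdiff g1" and "f2 = (fdiff ^^ N) g2"
  have f: "bdd_cpt_borel f1" "bdd_cpt_borel f2"
    unfolding f1_def f2_def by (intro bdd_cpt_borel_fdiff bdd_cpt_borel_funpow_fdiff g)+
  have supp1: "-1 \<le> s \<and> s \<le> 1" if "f1 s \<noteq> 0" for s
  proof (rule ccontr)
    assume "\<not> ?thesis"
    then show False using that by (auto simp: f1_def g1_def fdiff_def indicator_def)
  qed
  have "-4 - real n \<le> t \<and> t \<le> -3" if "(fdiff ^^ n) g2 t \<noteq> 0" for n t
    using that
  proof (induction n arbitrary: t)
    case 0
    then show ?case by (auto simp: g2_def indicator_def split: if_splits)
  next
    case (Suc n)
    then have "(fdiff ^^ n) g2 (t + 1) \<noteq> 0 \<or> (fdiff ^^ n) g2 t \<noteq> 0"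
      unfolding funpow_fdiff_Suc by auto
    then show ?case using Suc.IH[of "t + 1"] Suc.IH[of t] by auto
  qed
  then have supp2: "-4 - real N \<le> t \<and> t \<le> -3" if "f2 t \<noteq> 0" for t
    using that unfolding f2_def by blast
  have supp: "t + 1 \<le> s \<and> \<bar>s\<bar> \<le> real N + 4 \<and> \<bar>t\<bar> \<le> real N + 4" if "f1 s * f2 t \<noteq> 0" for s t
  proof -
    have "f1 s \<noteq> 0" "f2 t \<noteq> 0" using that by auto
    from supp1[OF this(1)] supp2[OF this(2)] show ?thesis by auto
  qed
  have mean_zero: "(LINT s|lborel. f1 s) = 0" unfolding f1_def by (rule integral_fdiff_eq_0[OF g(1)])
  have R: "0 < real N + 4" by simp
  have "fun_in_hardy 1 f1"
    using fun_in_hardy_fdiff[OF assms(6,7) g(1), of 1 1] by (simp add: f1_def)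
  moreover have "fun_in_hardy p f2"
    unfolding f2_def by (rule fun_in_hardy_fdiff[OF assms(6,7) g(2) assms(3) N])
  ultimately have "fun_in_hardy q (frac_int \<gamma> f1 f2)"
    using bdd bdd_cpt_borel_bdd_cpt_supp[OF f(1)] bdd_cpt_borel_bdd_cpt_supp[OF f(2)]
    unfolding hardy_bounded_def by blast
  then have zero: "(LINT x|lborel. frac_int \<gamma> f1 f2 x) = 0"
    unfolding fun_in_hardy_def
    using integral_eq_0_if_in_hardy[OF _ q]
      frac_int_integrable[OF assms(1,2) f R _ mean_zero, OF supp] by blast
  \<comment> \<open>The constant is \<open>(\<gamma> - 2) / (\<gamma> - 1)\<close>.\<close>
  have const: "complex_of_real (1 - 1 / (\<gamma> - 1)) \<noteq> 0"
    unfolding of_real_eq_0_iff using assms(1,2) by (simp add: field_simps)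
  have energy: "(LINT z|lborel. f1 (fst z) * f2 (snd z) * complex_of_real (\<bar>fst z - snd z\<bar> powr (\<gamma> - 1))) \<noteq> 0"
    unfolding f1_def f2_def g1_def g2_def by (rule fdiff_energy_nonzero) (use assms(1,2) in auto)
  have "(LINT x|lborel. frac_int \<gamma> f1 f2 x) = complex_of_real (1 - 1 / (\<gamma> - 1))
      * (LINT z|lborel. f1 (fst z) * f2 (snd z) * complex_of_real (\<bar>fst z - snd z\<bar> powr (\<gamma> - 1)))"
    by (rule frac_int_integral[unfolded tensor_def, OF assms(1,2) f R _ mean_zero]) (rule supp)
  then show False
    unfolding zero using no_zero_divisors[OF const energy] by (rule notE[OF _ sym, rotated])
qed

end
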